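(* Let $G$ be Thompson's group $T$ or Thompson's group $V$, let $S$ be a finite generating set for $G$, and let $\mathrm{CLF}$ be the conjugator length function of $G$ with respect to $S$. Then there exists a constant $C>0$ such that \[ \mathrm{CLF}(n)\ge Cn^2 \] for all $n\in\mathbb{N}$.
   Context: Thompson's group $V$ is the group of all right-continuous bijections $f$ of $[0,1)$ for which there are two partitions of $[0,1)$ into the same finite number of standard dyadic intervals $[a/2^m,(a+1)/2^m)$ such that $f$ maps each interval of the first partition onto an interval of the second by an increasing affine map. $T$ is the subgroup of those elements that induce homeomorphisms of the circle $[0,1]/\{0\sim1\}$. Both groups are finitely generated. Let $G$ be a group with finite generating set $S$ and let $\ell\colon G\to\mathbb{N}$ be the word length with respect to $S$ (and inverses). For conjugate $g,h\in G$, the conjugator distance is $\mathrm{cd}(g,h)=\min\{\ell(k)\mid k\in G\text{ and }h=k^{-1}gk\}$. The conjugator length function of $G$ with respect to $S$ is the nondecreasing function $\mathrm{CLF}\colon\mathbb{N}\to\mathbb{N}$ defined by \[ \mathrm{CLF}(n)=\max\{\mathrm{cd}(g,h)\mid g,h\in G\text{ are conjugate and }\ell(g)+\ell(h)\le n\}. \]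
   Formalization: The bound CLF(n) ≥ Cn² is proved for all sufficiently large n instead of all n: at n = 1 it fails for every C > 0, since CLF(1) = 0. After shrinking C, it holds for every n with CLF(n) > 0. *)

theory Defs
  imports "HOL-Analysis.Analysis" "HOL-Algebra.Bij" "HOL-Algebra.Generated_Groups"
    "HOL-Library.Disjoint_Sets"
begin


definition word_prod :: "('a, 'b) monoid_scheme \<Rightarrow> 'a list \<Rightarrow> 'a" where
  "word_prod G ws = foldr (\<lambda>x y. x \<otimes>\<^bsub>G\<^esub> y) ws \<one>\<^bsub>G\<^esub>"

definition word_length :: "('a, 'b) monoid_scheme \<Rightarrow> 'a set \<Rightarrow> 'a \<Rightarrow> nat" where
  "word_length G S g =
    (LEAST n. \<exists>ws. set ws \<subseteq> S \<union> (\<lambda>s. inv\<^bsub>G\<^esub> s) ` S \<and> length ws = n \<and> word_prod G ws = g)"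

definition conjugates :: "('a, 'b) monoid_scheme \<Rightarrow> 'a \<Rightarrow> 'a \<Rightarrow> bool" where
  "conjugates G g h \<longleftrightarrow> g \<in> carrier G \<and> h \<in> carrier G \<and>
    (\<exists>k \<in> carrier G. h = inv\<^bsub>G\<^esub> k \<otimes>\<^bsub>G\<^esub> g \<otimes>\<^bsub>G\<^esub> k)"

definition conjugator_distance :: "('a, 'b) monoid_scheme \<Rightarrow> 'a set \<Rightarrow> 'a \<Rightarrow> 'a \<Rightarrow> nat" where
  "conjugator_distance G S g h =
    (LEAST n. \<exists>k \<in> carrier G. h = inv\<^bsub>G\<^esub> k \<otimes>\<^bsub>G\<^esub> g \<otimes>\<^bsub>G\<^esub> k \<and> n = word_length G S k)"

definition CLF :: "('a, 'b) monoid_scheme \<Rightarrow> 'a set \<Rightarrow> nat \<Rightarrow> nat" where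
  "CLF G S n = Max {conjugator_distance G S g h | g h.
    conjugates G g h \<and> word_length G S g + word_length G S h \<le> n}"

context group
begin

lemma word_prod_closed: "set ws \<subseteq> carrier G \<Longrightarrow> word_prod G ws \<in> carrier G"
  by (induction ws) (auto simp: word_prod_def)

lemma word_prod_append:
  "set us \<subseteq> carrier G \<Longrightarrow> set vs \<subseteq> carrier G \<Longrightarrow>
    word_prod G (us @ vs) = word_prod G us \<otimes> word_prod G vs"
proof (induction us)
  case Nil
  then show ?case using word_prod_closed[of vs] by (simp add: word_prod_def)
next
  case (Cons u us)
  then show ?case using word_prod_closed[of us] word_prod_closed[of vs]
    by (simp add: word_prod_def m_assoc)
qed

lemma word_exists:
  assumes S: "S \<subseteq> carrier G" and g: "g \<in> generate G S"
  shows "\<exists>ws. set ws \<subseteq> S \<union> (\<lambda>s. inv s) ` S \<and> word_prod G ws = g"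
  using g
proof (induction rule: generate.induct)
  case one
  show ?case by (rule exI[of _ "[]"]) (simp add: word_prod_def)
next
  case (incl h)
  then show ?case using S by (intro exI[of _ "[h]"]) (auto simp: word_prod_def)
next
  case (inv h)
  then show ?case using S by (intro exI[of _ "[inv h]"]) (auto simp: word_prod_def)
next
  case (eng h1 h2)
  then obtain us vs where "set us \<subseteq> S \<union> (\<lambda>s. inv s) ` S" "word_prod G us = h1"
    "set vs \<subseteq> S \<union> (\<lambda>s. inv s) ` S" "word_prod G vs = h2" by blast
  moreover have "S \<union> (\<lambda>s. inv s) ` S \<subseteq> carrier G" using S by auto
  ultimately have "set (us @ vs) \<subseteq> S \<union> (\<lambda>s. inv s) ` S" "word_prod G (us @ vs) = h1 \<otimes> h2"
    using word_prod_append[of us vs] by (simp, metis subset_trans)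
  then show ?case by blast
qed

lemma word_length_witness:
  assumes "S \<subseteq> carrier G" "generate G S = carrier G" "g \<in> carrier G"
  obtains ws where "set ws \<subseteq> S \<union> (\<lambda>s. inv s) ` S" "length ws = word_length G S g"
    "word_prod G ws = g"
proof -
  have "\<exists>n ws. set ws \<subseteq> S \<union> (\<lambda>s. inv s) ` S \<and> length ws = n \<and> word_prod G ws = g"
    using word_exists[of S g] assms by auto
  then have "\<exists>ws. set ws \<subseteq> S \<union> (\<lambda>s. inv s) ` S \<and> length ws = word_length G S g \<and>
      word_prod G ws = g"
    unfolding word_length_def by (rule LeastI_ex)
  then show ?thesis using that by blast
qed

lemma word_length_one: "word_length G S \<one> = 0"
  unfolding word_length_def by (rule Least_eq_0) (auto simp: word_prod_def)

lemma word_length_eq_0: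
  assumes "S \<subseteq> carrier G" "generate G S = carrier G" "g \<in> carrier G" "word_length G S g = 0"
  shows "g = \<one>"
  using word_length_witness[OF assms(1-3)] assms(4) by (metis word_prod_def foldr.simps(1) id_apply length_0_conv)

lemma conjugator_distance_refl:
  assumes "g \<in> carrier G"
  shows "conjugator_distance G S g g = 0"
  unfolding conjugator_distance_def
  by (rule Least_eq_0) (use assms word_length_one in \<open>auto intro!: bexI[of _ \<one>]\<close>)

text \<open>The maximum in \<open>CLF\<close> is taken over a finite nonempty set, so it is a genuine maximum.\<close>

lemma CLF_set_finite:
  assumes "finite S" "S \<subseteq> carrier G" "generate G S = carrier G"
  shows "finite {conjugator_distance G S g h | g h.
    conjugates G g h \<and> word_length G S g + word_length G S h \<le> n}"
proof -
  let ?W = "word_prod G ` {ws. set ws \<subseteq> S \<union> (\<lambda>s. inv s) ` S \<and> length ws \<le> n}"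
  have fin: "finite ?W"
    using assms(1) by (intro finite_imageI finite_lists_length_le) auto
  have mem: "g \<in> ?W" if g: "g \<in> carrier G" "word_length G S g \<le> n" for g
  proof -
    obtain ws where "set ws \<subseteq> S \<union> (\<lambda>s. inv s) ` S" "length ws = word_length G S g"
      "word_prod G ws = g" using word_length_witness[OF assms(2,3) g(1)] by blast
    then show ?thesis using g(2) by force
  qed
  show ?thesis
    by (rule finite_subset[of _ "(\<lambda>(g, h). conjugator_distance G S g h) ` (?W \<times> ?W)"])
      (use mem fin in \<open>force simp: conjugates_def\<close>)+
qed

lemma CLF_set_nonempty:
  "{conjugator_distance G S g h | g h.
    conjugates G g h \<and> word_length G S g + word_length G S h \<le> n} \<noteq> {}"
proof -
  have "conjugates G \<one> \<one>" by (auto simp: conjugates_def)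
  then show ?thesis using word_length_one[of S] by fastforce
qed

text \<open>
  The value at 1 is 0 for every group and generating set, hence a bound \<open>CLF n \<ge> C * n^2\<close>
  with \<open>C > 0\<close> cannot hold at \<open>n = 1\<close>; it has to be read for large \<open>n\<close>.
\<close>

lemma CLF_1:
  assumes "S \<subseteq> carrier G" "generate G S = carrier G"
  shows "CLF G S 1 = 0"
proof -
  have "conjugator_distance G S g h = 0"
    if c: "conjugates G g h" and l: "word_length G S g + word_length G S h \<le> 1" for g h
  proof -
    obtain k where k: "g \<in> carrier G" "h \<in> carrier G" "k \<in> carrier G" "h = inv k \<otimes> g \<otimes> k"
      using c by (auto simp: conjugates_def)
    have "g = \<one> \<or> h = \<one>"
      using l word_length_eq_0[OF assms k(1)] word_length_eq_0[OF assms k(2)] by linarith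
    then have "g = h"
    proof
      assume "g = \<one>" then show ?thesis using k by simp
    next
      assume "h = \<one>"
      then have "k \<otimes> \<one> = k \<otimes> (inv k \<otimes> g \<otimes> k)" using k by simp
      also have "\<dots> = g \<otimes> k" using k by (simp add: m_assoc[symmetric])
      finally have "g \<otimes> k = k" using k by simp
      then show ?thesis using k \<open>h = \<one>\<close> by (metis r_cancel_one)
    qed
    then show ?thesis using conjugator_distance_refl k(1) by simp
  qed
  then have "{conjugator_distance G S g h | g h.
      conjugates G g h \<and> word_length G S g + word_length G S h \<le> 1} \<subseteq> {0}" by auto
  then have "{conjugator_distance G S g h | g h.
      conjugates G g h \<and> word_length G S g + word_length G S h \<le> 1} = {0}"
    using CLF_set_nonempty[of S 1] by (meson subset_singletonD)
  then show ?thesis unfolding CLF_def by (simp only: Max_singleton)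
qed

end



definition standard_dyadic :: "real set \<Rightarrow> bool" where
  "standard_dyadic I \<longleftrightarrow> (\<exists>a m :: nat. I = {real a / 2 ^ m ..< (real a + 1) / 2 ^ m})"

definition dyadic_partition :: "real set set \<Rightarrow> bool" where
  "dyadic_partition P \<longleftrightarrow> finite P \<and> partition_on {0..<1} P \<and> (\<forall>I\<in>P. standard_dyadic I)"

definition increasing_affine_on :: "real set \<Rightarrow> (real \<Rightarrow> real) \<Rightarrow> bool" where
  "increasing_affine_on I f \<longleftrightarrow> (\<exists>c d. c > 0 \<and> (\<forall>x\<in>I. f x = c * x + d))"

text \<open>
  Elements of \<open>Bij {0..<1}\<close> are extensional (\<open>undefined\<close> outside \<open>{0..<1}\<close>), so equality of
  functions is equality of bijections of \<open>[0,1)\<close>. The product in \<open>BijGroup\<close> is \<open>g \<circ> f\<close>. The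
  opposite convention (right actions) gives the same word lengths and only replaces each
  conjugator \<open>k\<close> by its inverse, so \<open>CLF\<close> is the same.
\<close>

definition thompson_V_set :: "(real \<Rightarrow> real) set" where
  "thompson_V_set = {f \<in> Bij {0..<1}.
    (\<forall>x\<in>{0..<1}. continuous (at_right x) f) \<and>
    (\<exists>P Q. dyadic_partition P \<and> dyadic_partition Q \<and> card P = card Q \<and>
      (\<forall>I\<in>P. f ` I \<in> Q \<and> increasing_affine_on I f))}"

text \<open>
  The circle \<open>[0,1]/{0~1}\<close>, with \<open>{0..<1}\<close> as the set of representatives: the quotient map
  is \<open>frac\<close>, which identifies 1 with 0 and fixes all other points. On these
  representatives the map of the circle induced by a bijection \<open>f\<close> of \<open>[0,1)\<close> is \<open>f\<close> itself.
\<close>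

definition circle :: "real topology" where
  "circle = topology (\<lambda>U. U \<subseteq> {0..<1} \<and>
    openin (top_of_set {0..1}) {x \<in> {0..1}. frac x \<in> U})"

lemma openin_circle:
  "openin circle U \<longleftrightarrow> U \<subseteq> {0..<1} \<and> openin (top_of_set {0..1}) {x \<in> {0..1}. frac x \<in> U}"
proof -
  have "istopology (\<lambda>U. U \<subseteq> {0..<1} \<and> openin (top_of_set {0..1::real}) {x \<in> {0..1}. frac x \<in> U})"
    unfolding istopology_def
  proof (intro conjI allI impI; (elim conjE)?)
    fix S T :: "real set"
    assume "openin (top_of_set {0..1}) {x \<in> {0..1}. frac x \<in> S}"
      "openin (top_of_set {0..1}) {x \<in> {0..1}. frac x \<in> T}"
    then have "openin (top_of_set {0..1})
        ({x \<in> {0..1}. frac x \<in> S} \<inter> {x \<in> {0..1}. frac x \<in> T})" by (rule openin_Int)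
    also have "{x \<in> {0..1}. frac x \<in> S} \<inter> {x \<in> {0..1}. frac x \<in> T} =
        {x \<in> {0..1}. frac x \<in> S \<inter> T}" by auto
    finally show "openin (top_of_set {0..1}) {x \<in> {0..1}. frac x \<in> S \<inter> T}" .
  next
    fix K :: "real set set"
    assume K: "\<forall>U\<in>K. U \<subseteq> {0..<1} \<and> openin (top_of_set {0..1}) {x \<in> {0..1}. frac x \<in> U}"
    have "openin (top_of_set {0..1}) (\<Union>U\<in>K. {x \<in> {0..1}. frac x \<in> U})"
      using K by (intro openin_Union) auto
    also have "(\<Union>U\<in>K. {x \<in> {0..1}. frac x \<in> U}) = {x \<in> {0..1}. frac x \<in> \<Union>K}" by auto
    finally show "openin (top_of_set {0..1}) {x \<in> {0..1}. frac x \<in> \<Union>K}" .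
  qed auto
  then show ?thesis unfolding circle_def by (simp add: topology_inverse')
qed

lemma topspace_circle: "topspace circle = {0..<1}"
proof -
  have "{x \<in> {0..1::real}. frac x \<in> {0..<1}} = {0..1}"
    by (auto simp: frac_lt_1)
  then have "openin circle {0..<1}" by (simp add: openin_circle)
  then show ?thesis
    by (metis openin_circle openin_subset openin_topspace subset_antisym)
qed

lemma quotient_map_circle: "quotient_map (top_of_set {0..1}) circle frac"
  unfolding quotient_map_def topspace_circle
proof (intro conjI allI impI)
  show "frac ` topspace (top_of_set {0..1}) = {0..<1::real}"
  proof
    show "{0..<1} \<subseteq> frac ` topspace (top_of_set {0..1::real})"
      by (auto intro!: image_eqI[where x = x for x] simp: frac_eq)
  qed (auto simp: frac_lt_1)
qed (simp add: openin_circle)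

definition thompson_T_set :: "(real \<Rightarrow> real) set" where
  "thompson_T_set = {f \<in> thompson_V_set. homeomorphic_map circle circle f}"

definition thompson_V :: "(real \<Rightarrow> real) monoid" where
  "thompson_V = (BijGroup {0..<1}) \<lparr>carrier := thompson_V_set\<rparr>"

definition thompson_T :: "(real \<Rightarrow> real) monoid" where
  "thompson_T = (BijGroup {0..<1}) \<lparr>carrier := thompson_T_set\<rparr>"

end

theory Submission
  imports Defs
begin

text \<open>
  Let \<open>x0\<close> be the standard generator of \<open>F\<close> contracting \<open>[0,1)\<close> to \<open>0\<close>. An element \<open>z\<close> of \<open>V\<close>
  commuting with \<open>x0\<close> fixes \<open>0\<close>, has slope a power of 2 there, and therefore satisfies
  \<open>x0\<^sup>m z = x0\<^sup>p\<close> for some \<open>m\<close>, \<open>p\<close>. Hence if \<open>k\<close> conjugates \<open>x0\<close> to \<open>h\<close>, then every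
  conjugator has as many points of non-affinity as \<open>k\<close> inside the fundamental domains of \<open>x0\<close>,
  and the number of such points bounds the word length from below up to a constant factor.

  Take an element \<open>f\<close> of length \<open>O(n)\<close> with \<open>n\<close> such points, supported in a fundamental domain of
  \<open>x0\<close>, and let \<open>k\<close> be the product of its \<open>n\<close> translates \<open>x0\<^sup>i f x0\<^sup>-\<^sup>i\<close>. Then \<open>k\<close> has \<open>n\<^sup>2\<close> such points,
  but conjugation telescopes: \<open>h = k\<^sup>-\<^sup>1 x0 k\<close> involves only the first and the last
  translate and has length \<open>O(n)\<close>. The element \<open>f\<close> arises from the same construction one scale below.
\<close>

section \<open>Copies of the generator of F\<close>

text \<open>
  \<open>bump u w\<close> is the copy on \<open>[u, u+w)\<close> of the generator of \<open>F\<close> with slopes 1/2, 1, 2;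
  each summand below is a change of slope.
\<close>

definition bump :: "real \<Rightarrow> real \<Rightarrow> real \<Rightarrow> real" where
  "bump u w x = x - max 0 (x - u) / 2 + max 0 (x - u - w/2) / 2
    + max 0 (x - u - 3*w/4) - max 0 (x - u - w)"

text \<open>Slopes 2, 1, 1/2. As for \<open>bump\<close>, the closed form with truncations makes
  continuity on the whole line immediate; computations use the pieces below.\<close>

definition bump_inv :: "real \<Rightarrow> real \<Rightarrow> real \<Rightarrow> real" where
  "bump_inv u w x = x + max 0 (x - u) - max 0 (x - u - w/4)
    - max 0 (x - u - w/2) / 2 + max 0 (x - u - w) / 2"

lemma bump_outside: "w \<ge> 0 \<Longrightarrow> x \<le> u \<or> u + w \<le> x \<Longrightarrow> bump u w x = x"
  unfolding bump_def by (auto simp: max_def field_simps)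

lemma bump_pieces:
  assumes "w \<ge> 0"
  shows "x \<le> u \<Longrightarrow> bump u w x = x"
    "u \<le> x \<Longrightarrow> x \<le> u + w/2 \<Longrightarrow> bump u w x = (x + u) / 2"
    "u + w/2 \<le> x \<Longrightarrow> x \<le> u + 3*w/4 \<Longrightarrow> bump u w x = x - w/4"
    "u + 3*w/4 \<le> x \<Longrightarrow> x \<le> u + w \<Longrightarrow> bump u w x = 2 * x - u - w"
    "u + w \<le> x \<Longrightarrow> bump u w x = x"
  using assms unfolding bump_def by (auto simp: max_def field_simps)

lemma bump_inv_pieces:
  assumes "w \<ge> 0"
  shows "x \<le> u \<Longrightarrow> bump_inv u w x = x"
    "u \<le> x \<Longrightarrow> x \<le> u + w/4 \<Longrightarrow> bump_inv u w x = 2 * x - u"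
    "u + w/4 \<le> x \<Longrightarrow> x \<le> u + w/2 \<Longrightarrow> bump_inv u w x = x + w/4"
    "u + w/2 \<le> x \<Longrightarrow> x \<le> u + w \<Longrightarrow> bump_inv u w x = (x + u + w) / 2"
    "u + w \<le> x \<Longrightarrow> bump_inv u w x = x"
  using assms unfolding bump_inv_def by (auto simp: max_def field_simps)

lemma bump_cases:
  assumes "w \<ge> 0"
  obtains (below) "x \<le> u" "bump u w x = x"
  | (half) "u \<le> x" "x \<le> u + w/2" "bump u w x = (x + u) / 2"
  | (shift) "u + w/2 \<le> x" "x \<le> u + 3*w/4" "bump u w x = x - w/4"
  | (double) "u + 3*w/4 \<le> x" "x \<le> u + w" "bump u w x = 2 * x - u - w"
  | (above) "u + w \<le> x" "bump u w x = x"
proof -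
  consider "x \<le> u" | "u \<le> x" "x \<le> u + w/2" | "u + w/2 \<le> x" "x \<le> u + 3*w/4"
    | "u + 3*w/4 \<le> x" "x \<le> u + w" | "u + w \<le> x" by linarith
  then show ?thesis
    by cases (rule that(1) that(2) that(3) that(4) that(5), (assumption | rule bump_pieces[OF assms])+)+
qed

lemma bump_inv_cases:
  assumes "w \<ge> 0"
  obtains (below) "x \<le> u" "bump_inv u w x = x"
  | (double) "u \<le> x" "x \<le> u + w/4" "bump_inv u w x = 2 * x - u"
  | (shift) "u + w/4 \<le> x" "x \<le> u + w/2" "bump_inv u w x = x + w/4"
  | (half) "u + w/2 \<le> x" "x \<le> u + w" "bump_inv u w x = (x + u + w) / 2"
  | (above) "u + w \<le> x" "bump_inv u w x = x"
proof -
  consider "x \<le> u" | "u \<le> x" "x \<le> u + w/4" | "u + w/4 \<le> x" "x \<le> u + w/2"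
    | "u + w/2 \<le> x" "x \<le> u + w" | "u + w \<le> x" by linarith
  then show ?thesis
    by cases (rule that(1) that(2) that(3) that(4) that(5), (assumption | rule bump_inv_pieces[OF assms])+)+
qed

lemma bump_inv_bump:
  assumes "w \<ge> 0"
  shows "bump_inv u w (bump u w x) = x"
  using assms
proof (cases rule: bump_cases[where u = u and x = x])
  case half
  have "bump_inv u w ((x + u) / 2) = 2 * ((x + u) / 2) - u"
    by (rule bump_inv_pieces[OF assms]) (use half in \<open>simp_all add: field_simps\<close>)
  then show ?thesis unfolding half(3) by (simp add: add_divide_distrib)
next
  case shift
  have "bump_inv u w (x - w/4) = x - w/4 + w/4"
    by (rule bump_inv_pieces(3)[OF assms]) (use shift in simp_all)
  then show ?thesis unfolding shift(3) by (simp add: add_divide_distrib)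
next
  case double
  have "bump_inv u w (2 * x - u - w) = (2 * x - u - w + u + w) / 2"
    by (rule bump_inv_pieces[OF assms]) (use double in simp_all)
  then show ?thesis unfolding double(3) by (simp add: add_divide_distrib)
qed (use assms in \<open>simp_all add: bump_inv_pieces\<close>)

lemma bump_bump_inv:
  assumes "w \<ge> 0"
  shows "bump u w (bump_inv u w x) = x"
  using assms
proof (cases rule: bump_inv_cases[where u = u and x = x])
  case double
  have "bump u w (2 * x - u) = (2 * x - u + u) / 2"
    by (rule bump_pieces[OF assms]) (use double in simp_all)
  then show ?thesis unfolding double(3) by (simp add: add_divide_distrib)
next
  case shift
  have "bump u w (x + w/4) = x + w/4 - w/4"
    by (rule bump_pieces(3)[OF assms]) (use shift in simp_all)
  then show ?thesis unfolding shift(3) by (simp add: add_divide_distrib)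
next
  case half
  have "bump u w ((x + u + w) / 2) = 2 * ((x + u + w) / 2) - u - w"
    by (rule bump_pieces[OF assms]) (use half in \<open>simp_all add: field_simps\<close>)
  then show ?thesis unfolding half(3) by (simp add: add_divide_distrib)
qed (use assms in \<open>simp_all add: bump_pieces\<close>)

lemma bump_le: "w \<ge> 0 \<Longrightarrow> bump u w x \<le> x"
  by (rule bump_cases[where u = u and w = w and x = x]) simp_all

lemma bump_ge: "w \<ge> 0 \<Longrightarrow> x \<ge> u \<Longrightarrow> bump u w x \<ge> u"
  by (rule bump_cases[where u = u and w = w and x = x]) simp_all

lemma bump_inv_ge: "w \<ge> 0 \<Longrightarrow> bump_inv u w x \<ge> x"
  by (rule bump_inv_cases[where u = u and w = w and x = x]) simp_all

lemma bump_inv_less: "w \<ge> 0 \<Longrightarrow> x < u + w \<Longrightarrow> bump_inv u w x < u + w"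
  by (rule bump_inv_cases[where u = u and w = w and x = x]) simp_all

lemma continuous_on_bump: "continuous_on A (bump u w)" "continuous_on A (bump_inv u w)"
  unfolding bump_def bump_inv_def by (intro continuous_intros; simp)+

section \<open>Membership in V and T\<close>

lemma image_affine_atLeastLessThan:
  fixes f :: "real \<Rightarrow> real"
  assumes "c > 0" "\<And>x. x \<in> {l..<r} \<Longrightarrow> f x = c * x + d"
  shows "f ` {l..<r} = {c * l + d..<c * r + d}"
proof -
  have "f ` {l..<r} = (\<lambda>x. c * x + d) ` {l..<r}"
    using assms(2) by (intro image_cong) auto
  also have "\<dots> = {c * l + d..<c * r + d}"
  proof (intro equalityI subsetI)
    fix y assume "y \<in> {c * l + d..<c * r + d}"
    then have "(y - d) / c \<in> {l..<r}" "y = c * ((y - d) / c) + d"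
      using assms(1) by (auto simp: field_simps)
    then show "y \<in> (\<lambda>x. c * x + d) ` {l..<r}" by blast
  qed (use assms(1) in auto)
  finally show ?thesis .
qed

text \<open>A half-open interval contains a right neighbourhood of each of its points, so right
  continuity is automatic on affine pieces.\<close>

lemma continuous_at_right_affine:
  assumes "increasing_affine_on I f" "standard_dyadic I" "x \<in> I"
  shows "continuous (at_right x) f"
proof -
  obtain c d where cd: "\<And>y. y \<in> I \<Longrightarrow> f y = c * y + d"
    using assms(1) by (auto simp: increasing_affine_on_def)
  obtain l r where I: "I = {l..<r}" using assms(2) by (auto simp: standard_dyadic_def)
  have "eventually (\<lambda>y. y \<in> I) (at_right x)"
    using assms(3) by (auto simp: I eventually_at_right_less intro!: eventually_at_rightI[of x r])
  then have ev: "eventually (\<lambda>y. f y = c * y + d) (at_right x)"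
    by eventually_elim (rule cd)
  have "((\<lambda>y. c * y + d) \<longlongrightarrow> c * x + d) (at_right x)"
    by (intro tendsto_intros)
  then have "(f \<longlongrightarrow> f x) (at_right x)"
    using ev cd[OF assms(3)] by (simp add: tendsto_cong)
  then show ?thesis by (simp add: continuous_within)
qed

lemma inj_on_Bij: "f \<in> Bij A \<Longrightarrow> inj_on f A"
  and image_Bij: "f \<in> Bij A \<Longrightarrow> f ` A = A"
  by (auto simp: Bij_def bij_betw_def)

text \<open>The images of the pieces form the second partition: injectivity keeps them disjoint and
  distinct, so the cardinalities agree, and right continuity follows from affinity.\<close>

lemma thompson_V_setI:
  assumes f: "f \<in> Bij {0..<1}" and P: "dyadic_partition P"
    and pieces: "\<And>I. I \<in> P \<Longrightarrow> standard_dyadic (f ` I)"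
      "\<And>I. I \<in> P \<Longrightarrow> increasing_affine_on I f"
  shows "f \<in> thompson_V_set"
proof -
  have fin: "finite P" and part: "partition_on {0..<1} P" and dyadic: "\<And>I. I \<in> P \<Longrightarrow> standard_dyadic I"
    using P by (auto simp: dyadic_partition_def)
  have cover: "\<Union>P = {0..<1}" using partition_onD1[OF part] by simp
  have rc: "continuous (at_right x) f" if x: "x \<in> {0..<1}" for x
  proof -
    obtain I where "I \<in> P" "x \<in> I" using x unfolding cover[symmetric] by blast
    then show ?thesis by (intro continuous_at_right_affine[OF pieces(2) dyadic])
  qed
  have "{} \<notin> (`) f ` P" using partition_onD3[OF part] by auto
  then have "dyadic_partition ((`) f ` P)"
    using partition_on_inj_image[OF part inj_on_Bij[OF f]] image_Bij[OF f] fin pieces(1)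
    by (auto simp: dyadic_partition_def)
  moreover have "card P = card ((`) f ` P)"
  proof (rule card_image[symmetric])
    show "inj_on ((`) f) P"
      using inj_on_image_Pow[OF inj_on_Bij[OF f]] by (rule inj_on_subset) (use cover in auto)
  qed
  ultimately show ?thesis
    using f rc P pieces(2) by (auto simp: thompson_V_set_def)
qed

text \<open>Distinct pieces have distinct images, so equal cardinality forces the images to exhaust
  the second partition.\<close>

lemma thompson_V_setE:
  assumes "f \<in> thompson_V_set"
  obtains P where "f \<in> Bij {0..<1}" "dyadic_partition P" "dyadic_partition ((`) f ` P)"
    "\<forall>I\<in>P. increasing_affine_on I f"
proof -
  obtain P Q where f: "f \<in> Bij {0..<1}" and PQ: "dyadic_partition P" "dyadic_partition Q"
      "card P = card Q" "\<And>I. I \<in> P \<Longrightarrow> f ` I \<in> Q" "\<And>I. I \<in> P \<Longrightarrow> increasing_affine_on I f"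
    using assms by (auto simp: thompson_V_set_def)
  have cover: "\<Union>P = {0..<1}" using PQ(1) by (auto simp: dyadic_partition_def partition_on_def)
  have "inj_on ((`) f) P"
    using inj_on_image_Pow[OF inj_on_Bij[OF f]] by (rule inj_on_subset) (use cover in auto)
  then have "card ((`) f ` P) = card Q" using PQ(3) by (simp add: card_image)
  then have "(`) f ` P = Q"
    using PQ by (intro card_subset_eq) (auto simp: dyadic_partition_def)
  then show ?thesis using that f PQ by blast
qed

lemma standard_dyadic_0:
  assumes "standard_dyadic J" "0 \<in> J"
  shows "\<exists>m. J = {0..<1 / 2 ^ m}"
proof -
  obtain a m :: nat where J: "J = {real a / 2 ^ m..<(real a + 1) / 2 ^ m}"
    using assms(1) by (auto simp: standard_dyadic_def)
  then have "real a / 2 ^ m \<le> 0" using assms(2) by simp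
  moreover have "(0::real) < 2 ^ m" by simp
  ultimately have "a = 0" unfolding divide_le_0_iff by linarith
  then show ?thesis using J by auto
qed

text \<open>The piece containing 0 and its image are standard dyadic intervals starting at 0, of
  lengths \<open>1 / 2 ^ m\<close> and \<open>1 / 2 ^ p\<close>. So the slope is a power of 2,
  written here without negative exponents.\<close>

lemma thompson_V_slope_at_0:
  assumes z: "z \<in> thompson_V_set" and z0: "z 0 = 0"
  shows "\<exists>c m p. c > 0 \<and> c / 2 ^ m = 1 / 2 ^ p \<and> (\<forall>x\<in>{0..<1 / 2 ^ m}. z x = c * x)"
proof -
  obtain P where "z \<in> Bij {0..<1}" and P: "dyadic_partition P" "dyadic_partition ((`) z ` P)"
      "\<forall>I\<in>P. increasing_affine_on I z"
    using z by (rule thompson_V_setE)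
  have "0 \<in> \<Union>P" using P(1) by (auto simp: dyadic_partition_def partition_on_def)
  then obtain I where I: "I \<in> P" "0 \<in> I" by blast
  then obtain m where m: "I = {0..<1 / 2 ^ m}"
    using standard_dyadic_0[of I] P(1) by (auto simp: dyadic_partition_def)
  have "0 \<in> z ` I" using z0 I(2) by force
  then obtain p where p: "z ` I = {0..<1 / 2 ^ p}"
    using standard_dyadic_0[of "z ` I"] P(2) I(1) by (auto simp: dyadic_partition_def)
  obtain c d where c: "c > 0" "\<And>x. x \<in> I \<Longrightarrow> z x = c * x + d"
    using P(3) I(1) by (auto simp: increasing_affine_on_def)
  have d: "d = 0" using c(2)[OF I(2)] z0 by simp
  have "{0..<c / 2 ^ m} = {0..<1 / 2 ^ p}"
    using image_affine_atLeastLessThan[of c 0 "1 / 2 ^ m" z d] c p by (simp add: m d)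
  then have "c / 2 ^ m = 1 / 2 ^ p" using c(1) by (subst (asm) atLeastLessThan_eq_iff) auto
  moreover have "\<forall>x\<in>{0..<1 / 2 ^ m}. z x = c * x" using c(2) m d by simp
  ultimately show ?thesis using c(1) by blast
qed

text \<open>The inverse exchanges the two partitions. \<open>restrict\<close> makes it the
  extensional inverse used by \<open>BijGroup\<close>.\<close>

lemma thompson_V_set_inv:
  assumes "f \<in> thompson_V_set"
  shows "restrict (inv_into {0..<1} f) {0..<1} \<in> thompson_V_set"
proof -
  obtain P where f: "f \<in> Bij {0..<1}" and P: "dyadic_partition P" "dyadic_partition ((`) f ` P)"
      "\<forall>I\<in>P. increasing_affine_on I f"
    using assms by (rule thompson_V_setE)
  have sub: "I \<subseteq> {0..<1}" if "I \<in> P" for I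
    using P(1) that unfolding dyadic_partition_def partition_on_def by blast
  let ?g = "restrict (inv_into {0..<1} f) {0..<1}"
  have gf: "?g (f x) = x" if "x \<in> {0..<1}" for x
    using inv_into_f_f[OF inj_on_Bij[OF f] that] image_Bij[OF f] that by auto
  show ?thesis
  proof (rule thompson_V_setI)
    show "?g \<in> Bij {0..<1}" using restrict_inv_into_Bij[OF f] by simp
    show "dyadic_partition ((`) f ` P)" by fact
  next
    fix J assume "J \<in> (`) f ` P"
    then obtain I where I: "I \<in> P" "J = f ` I" by blast
    have "?g (f x) = id x" if "x \<in> I" for x
      unfolding id_apply by (rule gf) (use sub[OF I(1)] that in blast)
    then have "?g ` J = id ` I" unfolding I(2) image_image by (intro image_cong refl)
    then show "standard_dyadic (?g ` J)" using P(1) I(1) by (simp add: dyadic_partition_def)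
    obtain c d where cd: "c > 0" "\<And>x. x \<in> I \<Longrightarrow> f x = c * x + d"
      using P(3) I(1) by (auto simp: increasing_affine_on_def)
    have "?g y = (1 / c) * y + (- d / c)" if y: "y \<in> J" for y
    proof -
      obtain x where x: "x \<in> I" "y = f x" using y I(2) by blast
      have "?g y = x" using gf x sub[OF I(1)] by blast
      then show ?thesis using cd x by (simp add: field_simps)
    qed
    then show "increasing_affine_on J ?g"
      unfolding increasing_affine_on_def using cd(1) by (intro exI[of _ "1/c"] exI[of _ "-d/c"]) simp
  qed
qed

text \<open>The continuous inverse on the circle agrees with the set-theoretic one on
  \<open>{0..<1}\<close>, which is therefore a homeomorphism too.\<close>

lemma thompson_T_set_inv:
  assumes "f \<in> thompson_T_set"
  shows "restrict (inv_into {0..<1} f) {0..<1} \<in> thompson_T_set"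
proof -
  let ?g = "restrict (inv_into {0..<1} f) {0..<1}"
  have f: "f \<in> thompson_V_set" "homeomorphic_map circle circle f"
    using assms by (auto simp: thompson_T_set_def)
  have b: "f \<in> Bij {0..<1}" using f(1) by (simp add: thompson_V_set_def)
  obtain h where h: "homeomorphic_maps circle circle f h"
    using f(2) homeomorphic_map_maps by blast
  have eq: "h y = ?g y" if y: "y \<in> {0..<1}" for y
  proof -
    obtain x where x: "x \<in> {0..<1}" "y = f x" using y image_Bij[OF b] by blast
    then have "h y = x" using h by (auto simp: homeomorphic_maps_def topspace_circle)
    moreover have "?g y = x" using x y inv_into_f_f[OF inj_on_Bij[OF b] x(1)] by simp
    ultimately show ?thesis by simp
  qed
  have "homeomorphic_map circle circle h"
    using h homeomorphic_maps_map by blast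
  then have "homeomorphic_map circle circle ?g"
    using eq by (rule homeomorphic_map_eq) (simp add: topspace_circle)
  then show ?thesis using thompson_V_set_inv[OF f(1)] by (simp add: thompson_T_set_def)
qed

section \<open>Dyadic copies of the generator of F lie in T\<close>

lemma nat_less_power2:
  assumes "b < 2 ^ m"
  shows "real b + 1 \<le> 2 ^ m"
proof -
  have "real (Suc b) \<le> real (2 ^ m)" using assms by (simp only: of_nat_le_iff Suc_le_eq)
  then show ?thesis by simp
qed

lemma dyadic_partition_uniform:
  "dyadic_partition ((\<lambda>b. {real b / 2 ^ m..<(real b + 1) / 2 ^ m}) ` {..<2 ^ m})" (is "dyadic_partition (?D ` _)")
proof -
  have "x \<in> \<Union>(?D ` {..<2 ^ m}) \<longleftrightarrow> x \<in> {0..<1}" for x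
  proof
    assume "x \<in> \<Union>(?D ` {..<2 ^ m})"
    then obtain b where b: "b < 2 ^ m" "x \<in> ?D b" by blast
    have "real b + 1 \<le> 2 ^ m" using b(1) by (rule nat_less_power2)
    then have "(real b + 1) / 2 ^ m \<le> 1" by (simp add: field_simps)
    moreover have "0 \<le> real b / 2 ^ m" by simp
    ultimately show "x \<in> {0..<1}" using b(2) by (simp only: atLeastLessThan_iff) linarith
  next
    assume x: "x \<in> {0..<1}"
    define b where "b = nat \<lfloor>x * 2 ^ m\<rfloor>"
    have b: "real b \<le> x * 2 ^ m" "x * 2 ^ m < real b + 1"
      using x by (auto simp: b_def)
    have "x * 2 ^ m < 2 ^ m" using x by simp
    then have "real b < real (2 ^ m)"
      using b(1) unfolding of_nat_power of_nat_numeral by (rule le_less_trans[rotated])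
    then have "b < 2 ^ m" by (simp only: of_nat_less_iff)
    moreover have "x \<in> ?D b" using b by (simp add: field_simps)
    ultimately show "x \<in> \<Union>(?D ` {..<2 ^ m})" by blast
  qed
  then have cover: "\<Union>(?D ` {..<2 ^ m}) = {0..<1}" by blast
  have disj: "a = b" if "x \<in> ?D a" "x \<in> ?D b" for a b x
  proof -
    have "real a < real b + 1" "real b < real a + 1" using that by (auto simp: field_simps)
    then show ?thesis by linarith
  qed
  have "partition_on {0..<1} (?D ` {..<2 ^ m})"
  proof (rule partition_onI)
    show "\<Union>(?D ` {..<2 ^ m}) = {0..<1}" by (rule cover)
    show "disjnt p q" if "p \<in> ?D ` {..<2 ^ m}" "q \<in> ?D ` {..<2 ^ m}" "p \<noteq> q" for p q
      using that disj unfolding disjnt_iff by blast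
    show "{} \<notin> ?D ` {..<2 ^ m}"
      by (auto simp: divide_less_cancel not_le)
  qed
  then show ?thesis unfolding dyadic_partition_def standard_dyadic_def by blast
qed

lemma bump_in_unit_interval:
  assumes "w \<ge> 0" "u \<ge> 0" "u + w \<le> 1"
  shows "x \<in> {0..<1} \<Longrightarrow> bump u w x \<in> {0..<1}" "x \<in> {0..<1} \<Longrightarrow> bump_inv u w x \<in> {0..<1}"
proof -
  assume x: "x \<in> {0..<1}"
  have "0 \<le> bump u w x"
    using bump_ge[OF assms(1), of u x] bump_pieces(1)[OF assms(1), of x u] assms(2) x
    by (cases "u \<le> x") auto
  then show "bump u w x \<in> {0..<1}" using bump_le[OF assms(1), of u x] x by simp
  have "bump_inv u w x < 1"
    using bump_inv_less[OF assms(1), of x u] bump_inv_pieces(5)[OF assms(1), of u x] assms(3) x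
    by (cases "x < u + w") auto
  then show "bump_inv u w x \<in> {0..<1}" using bump_inv_ge[OF assms(1), of x u] x by simp
qed

lemma restrict_bump_Bij:
  assumes "w \<ge> 0" "u \<ge> 0" "u + w \<le> 1"
  shows "restrict (bump u w) {0..<1} \<in> Bij {0..<1}"
proof -
  have "bij_betw (bump u w) {0..<1} {0..<1}"
    using bump_in_unit_interval[OF assms] assms(1)
    by (intro bij_betw_byWitness[where f' = "bump_inv u w"])
      (simp_all add: bump_inv_bump bump_bump_inv image_subset_iff)
  then show ?thesis by (simp add: Bij_def)
qed

text \<open>By the quotient property of \<open>frac\<close> it suffices that
  \<open>f \<circ> frac\<close> is continuous on [0,1]. Since \<open>f\<close> fixes both 0 and 1,
  this map equals \<open>frac \<circ> f\<close>.\<close>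

lemma continuous_map_circle:
  assumes f: "continuous_on {0..1} f" "\<And>x. x \<in> {0..<1} \<Longrightarrow> f x \<in> {0..<1}" "f 0 = 0" "f 1 = 1"
  shows "continuous_map circle circle f"
proof -
  have range: "f x \<in> {0..1}" if "x \<in> {0..1}" for x
    using f(2)[of x] f(4) that by (cases "x = 1") auto
  have "continuous_map (top_of_set {0..1}) (top_of_set {0..1}) f"
    using f(1) range by auto
  then have "continuous_map (top_of_set {0..1}) circle (frac \<circ> f)"
    using quotient_imp_continuous_map[OF quotient_map_circle] by (rule continuous_map_compose)
  moreover have "(frac \<circ> f) x = (f \<circ> frac) x" if "x \<in> topspace (top_of_set {0..1})" for x
  proof (cases "x = 1")
    case True then show ?thesis using f(3,4) by simp
  next
    case False
    then have "x \<in> {0..<1}" using that by auto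
    then have "frac x = x" "frac (f x) = f x" using f(2)[of x] by (auto simp: frac_eq)
    then show ?thesis by simp
  qed
  ultimately have "continuous_map (top_of_set {0..1}) circle (f \<circ> frac)"
    by (rule continuous_map_eq)
  then show ?thesis using quotient_map_circle by (rule continuous_compose_quotient_map[rotated])
qed

lemma restrict_bump_homeomorphic:
  assumes "w > 0" "u \<ge> 0" "u + w \<le> 1"
  shows "homeomorphic_map circle circle (restrict (bump u w) {0..<1})"
proof -
  have w: "w \<ge> 0" using assms(1) by simp
  have "continuous_map circle circle (bump u w)"
    by (rule continuous_map_circle[OF continuous_on_bump(1) bump_in_unit_interval(1)[OF w assms(2,3)]])
      (use assms in \<open>simp_all add: bump_pieces\<close>)
  moreover have "continuous_map circle circle (bump_inv u w)"
    by (rule continuous_map_circle[OF continuous_on_bump(2) bump_in_unit_interval(2)[OF w assms(2,3)]])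
      (use assms in \<open>simp_all add: bump_inv_pieces\<close>)
  ultimately have "homeomorphic_maps circle circle (bump u w) (bump_inv u w)"
    using w by (simp add: homeomorphic_maps_def bump_inv_bump bump_bump_inv)
  then have "homeomorphic_map circle circle (bump u w)"
    by (rule homeomorphic_maps_imp_map)
  then show ?thesis by (rule homeomorphic_map_eq) (simp add: topspace_circle)
qed

text \<open>The break points of the bump are multiples of a quarter of its width, so the uniform
  partition into cells of length \<open>1 / 2 ^ (m + 2)\<close> has only affine pieces.\<close>

lemma restrict_bump_thompson_T:
  assumes "a < 2 ^ m"
  shows "restrict (bump (real a / 2 ^ m) (1 / 2 ^ m)) {0..<1} \<in> thompson_T_set"
proof -
  define u w :: real where "u = real a / 2 ^ m" and "w = 1 / 2 ^ m"
  let ?f = "restrict (bump u w) {0..<1}"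
  define E :: real where "E = 2 ^ (m + 2)"
  have E: "E > 0" "u = 4 * real a / E" "w = 4 / E" by (simp_all add: E_def u_def w_def)
  have "real a + 1 \<le> 2 ^ m" using assms by (rule nat_less_power2)
  then have uw: "u \<ge> 0" "w > 0" "u + w \<le> 1"
    unfolding u_def w_def by (simp_all add: add_divide_distrib[symmetric])
  then have w: "w \<ge> 0" by simp
  have f: "?f \<in> Bij {0..<1}" by (rule restrict_bump_Bij[OF w uw(1,3)])
  define I where "I b = {real b / 2 ^ (m + 2)..<(real b + 1) / 2 ^ (m + 2)}" for b
  define P where "P = I ` {..<2 ^ (m + 2)}"
  have P: "dyadic_partition P" unfolding P_def I_def by (rule dyadic_partition_uniform)
  have "standard_dyadic (?f ` I b) \<and> increasing_affine_on (I b) ?f" if b: "b < 2 ^ (m + 2)" for b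
  proof -
    have "I b \<in> P" using b by (simp add: P_def)
    then have sub: "I b \<subseteq> {0..<1}"
      using P partition_onD1[of "{0..<1}" P] Union_upper[of "I b" P] by (simp add: dyadic_partition_def)
    \<comment> \<open>It remains to give, for each cell, the affine formula and the standard dyadic
      interval \<open>k\<close>, \<open>j\<close> that is its image.\<close>
    have *: "standard_dyadic (?f ` I b) \<and> increasing_affine_on (I b) ?f"
      if c: "c > 0" and cd: "\<And>x. real b / E \<le> x \<Longrightarrow> x \<le> (real b + 1) / E \<Longrightarrow> bump u w x = c * x + d"
        and k: "c * (real b / E) + d = real k / 2 ^ j"
          "c * ((real b + 1) / E) + d = (real k + 1) / 2 ^ j" for c d k j
    proof -
      have eq: "?f x = c * x + d" if "x \<in> I b" for x
        using subsetD[OF sub that] that cd[of x] by (simp add: I_def E_def)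
      then have "?f ` I b = {real k / 2 ^ j..<(real k + 1) / 2 ^ j}"
        using image_affine_atLeastLessThan[OF c, of "real b / E" "(real b + 1) / E" ?f d] k
        by (simp add: I_def E_def)
      then show ?thesis
        using eq c unfolding standard_dyadic_def increasing_affine_on_def by blast
    qed
    have le: "x \<le> r" if "x \<le> (real b + 1) / E" "real b + 1 \<le> E * r" for x r
      using that E(1) by (smt (verit) pos_divide_le_eq mult.commute)
    have ge: "r \<le> x" if "real b / E \<le> x" "E * r \<le> real b" for x r
      using that E(1) by (smt (verit) pos_le_divide_eq mult.commute)
    have Euw: "E * u = 4 * real a" "E * (u + w/2) = 4 * real a + 2" "E * (u + 3*w/4) = 4 * real a + 3"
        "E * (u + w) = 4 * real a + 4"
      using E by (simp_all add: field_simps)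
    \<comment> \<open>In units of \<open>1 / E\<close> the breaks are the integers 4a, 4a+2, 4a+3,
      4a+4, so no cell straddles one.\<close>
    consider "b < 4 * a" | "4 * a \<le> b" "b < 4 * a + 2" | "b = 4 * a + 2" | "b = 4 * a + 3"
      | "4 * a + 4 \<le> b" by linarith
    then show ?thesis
    proof cases
      case 1
      then have 1: "real b + 1 \<le> E * u" unfolding Euw by linarith
      show ?thesis
      proof (rule *[of 1 0 b "m + 2"])
        show "bump u w x = 1 * x + 0" if "real b / E \<le> x" "x \<le> (real b + 1) / E" for x
          using bump_pieces(1)[OF w le[OF that(2) 1]] by simp
      qed (simp_all add: E_def)
    next
      case 2
      then have 2: "E * u \<le> real b" "real b + 1 \<le> E * (u + w/2)" unfolding Euw by linarith+
      show ?thesis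
      \<comment> \<open>Halving towards \<open>u = 4 * a / E\<close> sends \<open>b / E\<close> to
        \<open>(b + 4 * a) / (2 * E)\<close>.\<close>
      proof (rule *[of "1/2" "u/2" "b + 4 * a" "m + 3"])
        show "bump u w x = 1/2 * x + u/2" if "real b / E \<le> x" "x \<le> (real b + 1) / E" for x
          using bump_pieces(2)[OF w ge[OF that(1) 2(1)] le[OF that(2) 2(2)]] by simp
      qed (simp_all add: E_def u_def field_simps power_add)
    next
      case 3
      then have 3: "E * (u + w/2) \<le> real b" "real b + 1 \<le> E * (u + 3*w/4)" unfolding Euw by simp_all
      show ?thesis
      proof (rule *[of "1" "-w/4" "b - 1" "m + 2"])
        show "bump u w x = 1 * x + -w/4" if "real b / E \<le> x" "x \<le> (real b + 1) / E" for x
          using bump_pieces(3)[OF w ge[OF that(1) 3(1)] le[OF that(2) 3(2)]] by simp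
      qed (use 3 in \<open>simp_all add: E_def w_def field_simps of_nat_diff \<open>b = 4 * a + 2\<close>\<close>)
    next
      case 4
      then have 4: "E * (u + 3*w/4) \<le> real b" "real b + 1 \<le> E * (u + w)" unfolding Euw by simp_all
      show ?thesis
      \<comment> \<open>For \<open>b = 4 * a + 3\<close> the left end goes to
        \<open>(2 * b - 4 * a - 4) / E = (4 * a + 2) / E\<close>, and the length doubles.\<close>
      proof (rule *[of 2 "-u-w" "2 * a + 1" "m + 1"])
        show "bump u w x = 2 * x + (-u-w)" if "real b / E \<le> x" "x \<le> (real b + 1) / E" for x
          using bump_pieces(4)[OF w ge[OF that(1) 4(1)] le[OF that(2) 4(2)]] by simp
      qed (simp_all add: E_def u_def w_def field_simps \<open>b = 4 * a + 3\<close>)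
    next
      case 5
      then have 5: "E * (u + w) \<le> real b" unfolding Euw by linarith
      show ?thesis
      proof (rule *[of 1 0 b "m + 2"])
        show "bump u w x = 1 * x + 0" if "real b / E \<le> x" "x \<le> (real b + 1) / E" for x
          using bump_pieces(5)[OF w ge[OF that(1) 5]] by simp
      qed (simp_all add: E_def)
    qed
  qed
  then have "?f \<in> thompson_V_set"
    by (intro thompson_V_setI[OF f P]) (auto simp: P_def)
  then show ?thesis
    using restrict_bump_homeomorphic[OF uw(2,1,3)] by (simp add: thompson_T_set_def u_def w_def)
qed

section \<open>Products of translates\<close>

context group
begin

text \<open>
  The product of the conjugates \<open>g\<^sup>i f g\<^sup>-\<^sup>i\<close> for \<open>i < n\<close>, written as a word
  whose length is linear in \<open>n\<close>.
\<close>

definition spread :: "'a \<Rightarrow> 'a \<Rightarrow> nat \<Rightarrow> 'a" where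
  "spread g f n = (f \<otimes> g) [^] n \<otimes> inv (g [^] n)"

lemma spread_closed [simp, intro]:
  "g \<in> carrier G \<Longrightarrow> f \<in> carrier G \<Longrightarrow> spread g f n \<in> carrier G"
  by (simp add: spread_def)

lemma spread_0: "spread g f 0 = \<one>"
  by (simp add: spread_def)

text \<open>Peels off the translate with \<open>i = 0\<close>; \<open>spread_Suc_right\<close> peels
  off the last one. Comparing the two recursions yields the telescoping in
  \<open>spread_conj\<close>.\<close>

lemma spread_Suc:
  assumes "g \<in> carrier G" "f \<in> carrier G"
  shows "spread g f (Suc n) = f \<otimes> (g \<otimes> spread g f n \<otimes> inv g)"
proof -
  have "(f \<otimes> g) [^] Suc n = (f \<otimes> g) \<otimes> (f \<otimes> g) [^] n"
    using assms by (intro nat_pow_Suc2) simp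
  moreover have "inv (g [^] Suc n) = inv (g [^] n) \<otimes> inv g"
    using assms nat_pow_Suc2[of g n] by (simp add: inv_mult_group)
  ultimately show ?thesis using assms by (simp add: spread_def m_assoc del: nat_pow_Suc)
qed

lemma spread_Suc_right:
  assumes "g \<in> carrier G" "f \<in> carrier G"
  shows "spread g f (Suc n) = spread g f n \<otimes> (g [^] n \<otimes> f \<otimes> inv (g [^] n))"
proof -
  have cancel: "inv x \<otimes> (x \<otimes> y) = y" "x \<otimes> (inv x \<otimes> y) = y"
    if "x \<in> carrier G" "y \<in> carrier G" for x y
    using that by (simp_all flip: m_assoc)
  have "spread g f n \<otimes> (g [^] n \<otimes> f \<otimes> inv (g [^] n)) = (f \<otimes> g) [^] n \<otimes> (f \<otimes> inv (g [^] n))"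
    using assms by (simp add: spread_def m_assoc cancel)
  moreover have "spread g f (Suc n) = (f \<otimes> g) [^] n \<otimes> (f \<otimes> inv (g [^] n))"
    using assms by (simp add: spread_def m_assoc inv_mult_group cancel)
  ultimately show ?thesis by simp
qed

lemma inv_left_cancel: "x \<in> carrier G \<Longrightarrow> y \<in> carrier G \<Longrightarrow> inv x \<otimes> (x \<otimes> y) = y"
  by (simp flip: m_assoc)

text \<open>With \<open>k = spread g f n\<close>, the two recursions give
  \<open>f (g k inv g) = k h\<close>, where \<open>h\<close> is the n-th translate. As
  \<open>f\<close> commutes with \<open>k\<close>, it can be moved across, leaving only the first
  and the last translate.\<close>

lemma spread_conj:
  assumes "g \<in> carrier G" "f \<in> carrier G" and comm: "f \<otimes> spread g f n = spread g f n \<otimes> f"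
  shows "g \<otimes> spread g f n = spread g f n \<otimes> (inv f \<otimes> (g [^] n \<otimes> f \<otimes> inv (g [^] n)) \<otimes> g)"
proof -
  let ?k = "spread g f n" and ?h = "g [^] n \<otimes> f \<otimes> inv (g [^] n)"
  have "f \<otimes> (g \<otimes> ?k \<otimes> inv g) = ?k \<otimes> ?h"
    using spread_Suc[OF assms(1,2)] spread_Suc_right[OF assms(1,2)] by simp
  then have "inv f \<otimes> (f \<otimes> (g \<otimes> ?k \<otimes> inv g)) = inv f \<otimes> (?k \<otimes> ?h)" by (rule arg_cong)
  then have "g \<otimes> ?k \<otimes> inv g = inv f \<otimes> (?k \<otimes> ?h)"
    using inv_left_cancel[of f "g \<otimes> ?k \<otimes> inv g"] assms(1,2) by simp
  also have "\<dots> = ?k \<otimes> (inv f \<otimes> ?h)"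
  proof -
    have "inv f \<otimes> ?k = ?k \<otimes> inv f"
    proof -
      have "f \<otimes> (?k \<otimes> inv f) = f \<otimes> ?k \<otimes> inv f" using assms(1,2) by (simp add: m_assoc)
      also have "\<dots> = ?k \<otimes> (f \<otimes> inv f)" unfolding comm using assms(1,2) by (simp add: m_assoc)
      finally have "f \<otimes> (?k \<otimes> inv f) = ?k" using assms(1,2) by simp
      then show ?thesis using inv_left_cancel[of f "?k \<otimes> inv f"] assms(1,2) by simp
    qed
    then show ?thesis using assms by (simp flip: m_assoc)
  qed
  finally have "g \<otimes> ?k = ?k \<otimes> (inv f \<otimes> ?h) \<otimes> g"
    using assms by (simp add: inv_solve_right')
  then show ?thesis using assms by (simp add: m_assoc)
qed

section \<open>Estimates for word length and conjugator length\<close>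

lemma word_length_le:
  assumes "set ws \<subseteq> S \<union> (\<lambda>s. inv s) ` S" "word_prod G ws = g"
  shows "word_length G S g \<le> length ws"
  unfolding word_length_def by (rule Least_le) (use assms in blast)

lemma word_length_mult:
  assumes S: "S \<subseteq> carrier G" "generate G S = carrier G" and "g \<in> carrier G" "h \<in> carrier G"
  shows "word_length G S (g \<otimes> h) \<le> word_length G S g + word_length G S h"
proof -
  obtain us where us: "set us \<subseteq> S \<union> (\<lambda>s. inv s) ` S" "length us = word_length G S g"
    "word_prod G us = g" using word_length_witness[OF S assms(3)] by blast
  obtain vs where vs: "set vs \<subseteq> S \<union> (\<lambda>s. inv s) ` S" "length vs = word_length G S h"
    "word_prod G vs = h" using word_length_witness[OF S assms(4)] by blast
  have "S \<union> (\<lambda>s. inv s) ` S \<subseteq> carrier G" using S(1) by auto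
  then have "word_prod G (us @ vs) = g \<otimes> h" using us vs word_prod_append[of us vs] by auto
  then show ?thesis using word_length_le[of "us @ vs" S] us vs by simp
qed

lemma word_length_inv:
  assumes S: "S \<subseteq> carrier G" "generate G S = carrier G" and "g \<in> carrier G"
  shows "word_length G S (inv g) \<le> word_length G S g"
proof -
  have *: "set ws \<subseteq> S \<union> (\<lambda>s. inv s) ` S \<Longrightarrow> word_length G S (inv (word_prod G ws)) \<le> length ws"
    for ws
  proof (induction ws)
    case Nil
    then show ?case by (simp add: word_prod_def word_length_one)
  next
    case (Cons s ws)
    have sub: "S \<union> (\<lambda>s. inv s) ` S \<subseteq> carrier G" using S(1) by auto
    have s: "s \<in> carrier G" and ws: "word_prod G ws \<in> carrier G"
      using Cons.prems sub by (auto intro!: word_prod_closed)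
    have "inv s \<in> S \<union> (\<lambda>s. inv s) ` S" using Cons.prems S(1) by auto
    then have "word_length G S (inv s) \<le> 1"
      using word_length_le[of "[inv s]" S "inv s"] s by (simp add: word_prod_def)
    moreover have "inv (word_prod G (s # ws)) = inv (word_prod G ws) \<otimes> inv s"
      using s ws by (simp add: word_prod_def inv_mult_group)
    ultimately show ?case
      using word_length_mult[OF S, of "inv (word_prod G ws)" "inv s"] Cons s ws by simp
  qed
  show ?thesis using word_length_witness[OF S assms(3)] * by metis
qed

lemma word_length_pow:
  assumes S: "S \<subseteq> carrier G" "generate G S = carrier G" and "g \<in> carrier G"
  shows "word_length G S (g [^] (n::nat)) \<le> n * word_length G S g"
proof (induction n)
  case (Suc n)
  then show ?case using word_length_mult[OF S, of "g [^] n" g] assms(3) by simp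
qed (simp add: word_length_one)

lemma word_length_spread:
  assumes S: "S \<subseteq> carrier G" "generate G S = carrier G" and "g \<in> carrier G" "f \<in> carrier G"
  shows "word_length G S (spread g f n) \<le> n * (2 * word_length G S g + word_length G S f)"
proof -
  let ?l = "word_length G S"
  have "?l (spread g f n) \<le> ?l ((f \<otimes> g) [^] n) + ?l (inv (g [^] n))"
    unfolding spread_def using word_length_mult[OF S] assms by simp
  also have "\<dots> \<le> n * ?l (f \<otimes> g) + n * ?l g"
    using word_length_pow[OF S, of "f \<otimes> g" n] word_length_pow[OF S, of g n]
      word_length_inv[OF S, of "g [^] n"] assms by simp
  also have "\<dots> \<le> n * (?l f + ?l g) + n * ?l g"
    using word_length_mult[OF S, of f g] assms by simp
  finally show ?thesis by (simp add: algebra_simps)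
qed

text \<open>The minimum is attained; the relation is put in the form \<open>g c = c h\<close>, free
  of inverses, for later cancellation.\<close>

lemma conjugator_distance_witness:
  assumes "conjugates G g h"
  obtains c where "c \<in> carrier G" "g \<otimes> c = c \<otimes> h" "word_length G S c = conjugator_distance G S g h"
proof -
  have "\<exists>n. \<exists>k\<in>carrier G. h = inv k \<otimes> g \<otimes> k \<and> n = word_length G S k"
    using assms by (auto simp: conjugates_def)
  then have "\<exists>k\<in>carrier G. h = inv k \<otimes> g \<otimes> k \<and> conjugator_distance G S g h = word_length G S k"
    unfolding conjugator_distance_def by (rule LeastI_ex)
  then obtain k where k: "k \<in> carrier G" "h = inv k \<otimes> g \<otimes> k"
    "conjugator_distance G S g h = word_length G S k" by blast
  have "g \<in> carrier G" using assms by (simp add: conjugates_def)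
  then have "g \<otimes> k = k \<otimes> h"
    using k(1) unfolding k(2) by (simp flip: m_assoc)
  then show ?thesis using that k by simp
qed

lemma CLF_ge:
  assumes "finite S" "S \<subseteq> carrier G" "generate G S = carrier G"
    and "conjugates G g h" "word_length G S g + word_length G S h \<le> n"
  shows "conjugator_distance G S g h \<le> CLF G S n"
  unfolding CLF_def using CLF_set_finite[OF assms(1-3)] by (rule Max_ge) (use assms(4,5) in blast)

end

section \<open>Groups of bijections and supports\<close>

text \<open>A common setting for T and V in which products, powers and inverses can be evaluated
  pointwise.\<close>

locale bijection_group = group G for G :: "('a \<Rightarrow> 'a) monoid" (structure) +
  fixes X :: "'a set"
  assumes subgroup: "subgroup (carrier G) (BijGroup X)"
    and G_eq: "G = (BijGroup X) \<lparr>carrier := carrier G\<rparr>"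
begin

lemma carrier_Bij: "f \<in> carrier G \<Longrightarrow> f \<in> Bij X"
  using subgroup.subset[OF subgroup] by (auto simp: BijGroup_def)

lemma apply_closed: "f \<in> carrier G \<Longrightarrow> x \<in> X \<Longrightarrow> f x \<in> X"
  using Bij_imp_funcset[OF carrier_Bij] by blast

lemma mult_apply:
  assumes "f \<in> carrier G" "h \<in> carrier G" "x \<in> X"
  shows "(f \<otimes> h) x = f (h x)"
proof -
  have "f \<otimes> h = compose X f h"
    using carrier_Bij[OF assms(1)] carrier_Bij[OF assms(2)] by (subst G_eq) (simp add: BijGroup_def)
  then show ?thesis using assms(3) by (simp add: compose_eq)
qed

lemma one_apply: "x \<in> X \<Longrightarrow> \<one> x = x"
  by (subst G_eq) (simp add: BijGroup_def)

lemma inv_apply: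
  assumes "f \<in> carrier G" "x \<in> X"
  shows "(inv f) (f x) = x" "f ((inv f) x) = x"
  using assms mult_apply[of "inv f" f x] mult_apply[of f "inv f" x] by (simp_all add: one_apply)

lemma pow_apply:
  assumes "f \<in> carrier G" "x \<in> X"
  shows "(f [^] (n::nat)) x = (f ^^ n) x"
  using assms(2)
proof (induction n arbitrary: x)
  case (Suc n)
  then show ?case using mult_apply[of "f [^] n" f x] assms(1) by (simp add: apply_closed funpow_swap1)
qed (simp add: one_apply)

lemma eqI:
  assumes "f \<in> carrier G" "h \<in> carrier G" "\<And>x. x \<in> X \<Longrightarrow> f x = h x"
  shows "f = h"
  using Bij_imp_extensional[OF carrier_Bij[OF assms(1)]]
    Bij_imp_extensional[OF carrier_Bij[OF assms(2)]] assms(3) by (rule extensionalityI)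

lemma apply_inj: "f \<in> carrier G \<Longrightarrow> x \<in> X \<Longrightarrow> y \<in> X \<Longrightarrow> f x = f y \<Longrightarrow> x = y"
  by (metis inv_apply(1))

text \<open>\<open>f\<close> maps \<open>A\<close> into itself: a point of \<open>A\<close> sent
  outside would land on a fixed point of \<open>f\<close>, against injectivity. In the same way
  \<open>h\<close> preserves the complement of \<open>A\<close>, so at each point only one of the
  two maps acts.\<close>

lemma disjoint_supports_commute:
  assumes "f \<in> carrier G" "h \<in> carrier G"
    and f: "\<And>x. x \<in> X - A \<Longrightarrow> f x = x" and h: "\<And>x. x \<in> X \<inter> A \<Longrightarrow> h x = x"
  shows "f \<otimes> h = h \<otimes> f"
proof (rule eqI)
  fix x assume x: "x \<in> X"
  have "f (h x) = h (f x)"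
  proof (cases "x \<in> A")
    case True
    then have "h x = x" using h x by simp
    moreover have "f x \<in> A"
      using True x f[of "f x"] apply_inj[OF assms(1) _ x] apply_closed[OF assms(1) x] by force
    ultimately show ?thesis using h apply_closed[OF assms(1) x] by simp
  next
    case False
    then have "f x = x" using f x by simp
    moreover have "h x \<notin> A"
      using False x h[of "h x"] apply_inj[OF assms(2) _ x] apply_closed[OF assms(2) x] by force
    ultimately show ?thesis using f apply_closed[OF assms(2) x] by simp
  qed
  then show "(f \<otimes> h) x = (h \<otimes> f) x" using assms x by (simp add: mult_apply)
qed (use assms in simp_all)

text \<open>\<open>D\<close> plays the role of a fundamental domain of \<open>g\<close>, and \<open>E\<close> is the union of its
  forward translates.\<close>

lemma spread_support:
  assumes gf: "g \<in> carrier G" "f \<in> carrier G"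
    and f: "\<And>x. x \<in> X - D \<Longrightarrow> f x = x"
    and DE: "D \<inter> E = {}" and g: "\<And>x. x \<in> X \<Longrightarrow> g x \<in> E \<longleftrightarrow> x \<in> D \<union> E"
  shows "x \<in> X - (D \<union> E) \<Longrightarrow> spread g f n x = x"
proof (induction n arbitrary: x)
  case (Suc n)
  have x: "x \<in> X" "(inv g) x \<in> X" using Suc.prems gf by (auto intro: apply_closed)
  \<comment> \<open>\<open>g\<close> says that the preimage of \<open>E\<close> is
    \<open>D \<union> E\<close>, so a point outside \<open>E\<close> is pulled back to a point
    outside \<open>D \<union> E\<close>.\<close>
  have "(inv g) x \<notin> D \<union> E" using g[of "(inv g) x"] x Suc.prems inv_apply(2)[OF gf(1) x(1)] by auto
  then have "spread g f n ((inv g) x) = (inv g) x" using x by (intro Suc.IH) auto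
  then show ?case
    using gf x f[of x] Suc.prems by (simp add: spread_Suc mult_apply inv_apply apply_closed)
qed (simp add: spread_0 one_apply)

text \<open>Apart from the factor \<open>f\<close> itself, the product consists of the translates
  with \<open>i \<ge> 1\<close>; these fix \<open>D\<close> pointwise, while \<open>f\<close> is
  supported in \<open>D\<close>.\<close>

lemma spread_commute:
  assumes gf: "g \<in> carrier G" "f \<in> carrier G"
    and f: "\<And>x. x \<in> X - D \<Longrightarrow> f x = x"
    and DE: "D \<inter> E = {}" and g: "\<And>x. x \<in> X \<Longrightarrow> g x \<in> E \<longleftrightarrow> x \<in> D \<union> E"
  shows "f \<otimes> spread g f n = spread g f n \<otimes> f"
proof (cases n)
  case 0
  then show ?thesis using gf by (simp add: spread_0)
next
  case (Suc m)
  let ?h = "g \<otimes> spread g f m \<otimes> inv g"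
  have "?h x = x" if x: "x \<in> X \<inter> D" for x
  proof -
    have x': "x \<in> X" "(inv g) x \<in> X" using x gf by (auto intro: apply_closed)
    have "(inv g) x \<notin> D \<union> E" using g[of "(inv g) x"] x' x DE inv_apply(2)[OF gf(1) x'(1)] by auto
    then have "spread g f m ((inv g) x) = (inv g) x"
      using x' by (intro spread_support[OF gf f DE g]) auto
    then show ?thesis using gf x' by (simp add: mult_apply inv_apply apply_closed)
  qed
  then have "f \<otimes> ?h = ?h \<otimes> f"
    using disjoint_supports_commute[of f ?h D] gf f by simp
  moreover have "?h \<in> carrier G" using gf by simp
  ultimately have "f \<otimes> (f \<otimes> ?h) = f \<otimes> ?h \<otimes> f" using gf(2) by (metis m_assoc)
  then show ?thesis using gf by (simp add: Suc spread_Suc)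
qed

text \<open>Only the i-th factor acts on the i-th translate of \<open>D\<close>. For
  \<open>i = 0\<close> the inner product fixes \<open>(inv g) x\<close>, which lies outside
  \<open>D \<union> E\<close>; for \<open>i > 0\<close> the outer \<open>f\<close> acts trivially,
  because the point reached lies in \<open>E\<close>.\<close>

lemma spread_apply:
  assumes gf: "g \<in> carrier G" "f \<in> carrier G"
    and f: "\<And>x. x \<in> X - D \<Longrightarrow> f x = x"
    and DE: "D \<inter> E = {}" and g: "\<And>x. x \<in> X \<Longrightarrow> g x \<in> E \<longleftrightarrow> x \<in> D \<union> E"
    and x: "x \<in> X \<inter> D"
  shows "i < n \<Longrightarrow> spread g f n ((g ^^ i) x) = (g ^^ i) (f x)"
proof (induction n arbitrary: i)
  case (Suc n)
  have X: "(g ^^ j) y \<in> X" if "y \<in> X" for j y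
    by (induction j) (use that gf in \<open>auto intro: apply_closed\<close>)
  \<comment> \<open>If \<open>f x\<close> left \<open>D\<close>, it would be fixed by
    \<open>f\<close>, and injectivity would give \<open>f x = x\<close>.\<close>
  have fx: "f x \<in> X \<inter> D"
    using x f[of "f x"] apply_inj[OF gf(2), of "f x" x] apply_closed[OF gf(2), of x] by force
  show ?case
  proof (cases i)
    case 0
    have x': "x \<in> X" "(inv g) x \<in> X" using x gf by (auto intro: apply_closed)
    have "(inv g) x \<notin> D \<union> E" using g[of "(inv g) x"] x' x DE inv_apply(2)[OF gf(1) x'(1)] by auto
    then have "spread g f n ((inv g) x) = (inv g) x"
      using x' by (intro spread_support[OF gf f DE g]) auto
    then show ?thesis using gf x' 0 by (simp add: spread_Suc mult_apply inv_apply apply_closed)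
  next
    case (Suc j)
    have E: "(g ^^ Suc j) (f x) \<in> E"
    proof (induction j)
      case 0
      then show ?case using g[of "f x"] fx by simp
    next
      case (Suc j)
      then show ?case using g[of "(g ^^ Suc j) (f x)"] X[of "f x" "Suc j"] fx by simp
    qed
    have "spread g f (Suc n) ((g ^^ i) x) = f (g (spread g f n ((g ^^ j) x)))"
      using gf X[of x j] x Suc by (simp add: spread_Suc mult_apply inv_apply apply_closed)
    also have "\<dots> = f ((g ^^ Suc j) (f x))" using Suc.IH[of j] Suc.prems Suc by simp
    also have "\<dots> = (g ^^ Suc j) (f x)" using E DE f X[of "f x" "Suc j"] fx by blast
    finally show ?thesis using Suc by simp
  qed
qed simp

end

section \<open>Points of non-affinity\<close>

text \<open>The neighbourhood is two-sided, so a jump of an element of V counts as a point of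
  non-affinity just like a change of slope.\<close>

definition locally_affine_at :: "(real \<Rightarrow> real) \<Rightarrow> real \<Rightarrow> bool" where
  "locally_affine_at f x \<longleftrightarrow> (\<exists>c d. c > 0 \<and> (\<forall>\<^sub>F y in nhds x. f y = c * y + d))"

text \<open>Only interior points are counted, since functions on \<open>{0..<1}\<close> carry no
  information to the left of 0.\<close>

definition breaks :: "(real \<Rightarrow> real) \<Rightarrow> real set" where
  "breaks f = {x \<in> {0<..<1}. \<not> locally_affine_at f x}"

lemma locally_affine_at_affine: "c > 0 \<Longrightarrow> locally_affine_at (\<lambda>y. c * y + d) x"
  unfolding locally_affine_at_def by (intro exI[of _ c] exI[of _ d]) simp

lemma locally_affine_at_cong:
  assumes "\<forall>\<^sub>F y in nhds x. f y = g y" "locally_affine_at g x"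
  shows "locally_affine_at f x"
proof -
  obtain c d where c: "c > 0" "\<forall>\<^sub>F y in nhds x. g y = c * y + d"
    using assms(2) by (auto simp: locally_affine_at_def)
  from assms(1) c(2) have "\<forall>\<^sub>F y in nhds x. f y = c * y + d" by eventually_elim simp
  then show ?thesis using c(1) by (auto simp: locally_affine_at_def)
qed

lemma locally_affine_at_compose:
  assumes f: "locally_affine_at f x" and g: "locally_affine_at g (f x)"
  shows "locally_affine_at (\<lambda>y. g (f y)) x"
proof -
  obtain c d where c: "c > 0" "\<forall>\<^sub>F y in nhds x. f y = c * y + d"
    using f by (auto simp: locally_affine_at_def)
  obtain a b where a: "a > 0" "\<forall>\<^sub>F y in nhds (f x). g y = a * y + b"
    using g by (auto simp: locally_affine_at_def)
  have "((\<lambda>y. c * y + d) \<longlongrightarrow> c * x + d) (nhds x)"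
    by (intro tendsto_intros filterlim_ident)
  moreover have "f x = c * x + d" using c(2) by (rule eventually_nhds_x_imp_x)
  ultimately have "(f \<longlongrightarrow> f x) (nhds x)" using c(2) by (simp add: tendsto_cong)
  then have "\<forall>\<^sub>F y in nhds x. g (f y) = a * f y + b"
    using a(2) by (rule eventually_compose_filterlim[rotated])
  with c(2) have "\<forall>\<^sub>F y in nhds x. g (f y) = (a * c) * y + (a * d + b)"
    by eventually_elim (simp add: algebra_simps)
  then show ?thesis using a(1) c(1) unfolding locally_affine_at_def by (meson mult_pos_pos)
qed

lemma locally_affine_atE:
  assumes "locally_affine_at f x"
  obtains c e d where "c > 0" "e > 0" "\<And>y. \<bar>y - x\<bar> < e \<Longrightarrow> f y = c * y + d"
  using assms unfolding locally_affine_at_def eventually_nhds_metric dist_real_def by blast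

lemma eventually_nhds_interval:
  fixes x :: real
  assumes "l < x" "x < r"
  shows "\<forall>\<^sub>F y in nhds x. l < y \<and> y < r"
  using eventually_nhds_in_open[of "{l<..<r}" x] assms by simp

text \<open>Every point of a half-open piece except its left end has a neighbourhood inside the
  piece, so only left ends can be breaks.\<close>

lemma finite_breaks:
  assumes "f \<in> thompson_V_set"
  shows "finite (breaks f)"
proof -
  obtain P where "f \<in> Bij {0..<1}" and P: "dyadic_partition P" and "dyadic_partition ((`) f ` P)"
    and affine: "\<forall>I\<in>P. increasing_affine_on I f"
    using assms by (rule thompson_V_setE)
  have "breaks f \<subseteq> Inf ` P"
  proof
    fix x assume x: "x \<in> breaks f"
    then have "x \<in> \<Union>P" using P
      by (auto simp: breaks_def dyadic_partition_def partition_on_def)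
    then obtain I where I: "I \<in> P" "x \<in> I" by blast
    then obtain l r where lr: "I = {l..<r}"
      using P by (auto simp: dyadic_partition_def standard_dyadic_def)
    obtain c d where c: "c > 0" "\<And>y. y \<in> I \<Longrightarrow> f y = c * y + d"
      using affine I(1) by (auto simp: increasing_affine_on_def)
    have "x = l"
    proof (rule ccontr)
      assume "x \<noteq> l"
      then have "l < x" "x < r" using I(2) lr by auto
      then have "\<forall>\<^sub>F y in nhds x. l < y \<and> y < r" by (rule eventually_nhds_interval)
      then have "\<forall>\<^sub>F y in nhds x. f y = c * y + d"
        by (rule eventually_mono) (use c(2) lr in auto)
      then show False using x c(1) by (auto simp: breaks_def locally_affine_at_def)
    qed
    moreover have "Inf I = l" using lr I(2) by (simp add: cInf_atLeastLessThan)
    ultimately show "x \<in> Inf ` P" using I(1) by blast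
  qed
  then show ?thesis using P finite_surj by (auto simp: dyadic_partition_def)
qed

section \<open>Orbits of the generator on [0,1)\<close>

definition bump_on :: "real \<Rightarrow> real \<Rightarrow> real \<Rightarrow> real" where
  "bump_on u w = restrict (bump u w) {0..<1}"

lemma bump_on_apply: "0 \<le> x \<Longrightarrow> x < 1 \<Longrightarrow> bump_on u w x = bump u w x"
  by (simp add: bump_on_def)

lemma bump_on_closed:
  assumes "0 \<le> u" "u + w \<le> 1" "0 < w" "x \<in> {0..<1}"
  shows "bump_on u w x \<in> {0..<1}"
  using bump_in_unit_interval(1)[of w u x] assms by (simp add: bump_on_apply)

lemma bump_half:
  assumes "0 \<le> u" "u + w \<le> 1" "0 < w" "u \<le> x" "x < u + w/2"
  shows "bump_on u w x = (x + u) / 2"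
  using assms bump_pieces(2)[of w u x] by (simp add: bump_on_apply)

lemma divide_power2_le: "0 \<le> t \<Longrightarrow> t / 2 ^ n \<le> (t :: real)"
  using divide_left_mono[of 1 "2 ^ n" t] by simp

lemma bump_funpow_half:
  assumes "0 \<le> u" "u + w \<le> 1" "0 < w" "u \<le> x" "x < u + w/2"
  shows "(bump_on u w ^^ n) x = u + (x - u) / 2 ^ n"
proof (induction n)
  case (Suc n)
  define z where "z = (x - u) / 2 ^ n"
  have "0 \<le> z" "z \<le> x - u"
    using assms(4) divide_power2_le[of "x - u" n] by (simp_all add: z_def)
  then have "bump_on u w (u + z) = (u + z + u) / 2"
    using assms by (intro bump_half) simp_all
  also have "\<dots> = u + z / 2" by simp
  finally show ?case using Suc by (simp add: z_def)
qed simp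

text \<open>The generator doubles the distance to 1 while this is at most 1/4. The bound
  \<open>t \<le> 1/2\<close> keeps every distance \<open>t / 2 ^ i\<close> with
  \<open>i \<ge> 1\<close> in that range.\<close>

lemma bump_01_funpow_near_1:
  assumes "1/4 < t" "t \<le> 1/2"
  shows "(bump_on 0 1 ^^ j) (1 - t / 2 ^ j) = 1 - t"
proof (induction j)
  case (Suc j)
  define s where "s = t / 2 ^ Suc j"
  have "s = t / 2 / 2 ^ j" by (simp add: s_def)
  then have "s \<le> t / 2" using divide_power2_le[of "t / 2" j] assms by linarith
  moreover have "s > 0" using assms by (simp add: s_def)
  ultimately have "s \<le> 1/4" "s > 0" using assms by simp_all
  then have "bump_on 0 1 (1 - s) = 1 - 2 * s"
    by (simp add: bump_on_apply bump_pieces)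
  moreover have "2 * s = t / 2 ^ j" by (simp add: s_def)
  ultimately show ?case using Suc by (simp add: funpow_Suc_right s_def del: funpow.simps)
qed simp

text \<open>All orbits converge to 0: the distance to 1 doubles until it is at least 1/4, two more
  steps lead to [0, 1/4], and from there each step halves the point.\<close>

lemma bump_01_funpow_small:
  assumes "x \<in> {0..<1}" "e > 0"
  obtains N where "(bump_on 0 1 ^^ N) x \<in> {0..<e}"
proof -
  let ?f = "bump_on 0 1"
  have X: "(?f ^^ n) x \<in> {0..<1}" for n
    using assms(1) bump_on_closed[of 0 1] by (induction n) auto
  have low: "min (1/4) (2 ^ n * (1 - x)) \<le> 1 - (?f ^^ n) x" for n
  proof (induction n)
    case (Suc n)
    have "min (1/4) (2 * (1 - y)) \<le> 1 - ?f y" if "y \<in> {0..<1}" for y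
      using that by (cases "y \<le> 1/2"; cases "y \<le> 3/4") (simp_all add: bump_on_apply bump_pieces)
    from this[OF X[of n]] have "min (1/4) (2 * (1 - (?f ^^ n) x)) \<le> 1 - (?f ^^ Suc n) x" by simp
    moreover have "min (1/4) (2 ^ Suc n * (1 - x)) \<le> min (1/4) (2 * (1 - (?f ^^ n) x))"
      using Suc by (simp add: min_def split: if_splits)
    ultimately show ?case by (rule order_trans[rotated])
  qed simp
  obtain n where n: "1 / (1 - x) < 2 ^ n" using real_arch_pow[of 2 "1 / (1 - x)"] by auto
  then have "2 ^ n * (1 - x) > 1" using assms(1) by (simp add: divide_less_eq)
  then have "(?f ^^ n) x \<le> 3/4" using low[of n] by simp
  then have "(?f ^^ Suc n) x \<le> 1/2" using X[of n]
    by (cases "(?f ^^ n) x \<le> 1/2") (simp_all add: bump_on_apply bump_pieces)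
  then have "(?f ^^ Suc (Suc n)) x \<le> 1/4" using X[of "Suc n"] by (simp add: bump_on_apply bump_pieces)
  moreover define y where "y = (?f ^^ Suc (Suc n)) x"
  ultimately have y: "0 \<le> y" "y \<le> 1/4" using X[of "Suc (Suc n)"] by auto
  obtain m where m: "1 / e < 2 ^ m" using real_arch_pow[of 2 "1 / e"] by auto
  have "(?f ^^ (m + Suc (Suc n))) x = y / 2 ^ m"
    using bump_funpow_half[of 0 1 y m] y unfolding funpow_add o_apply y_def[symmetric] by simp
  moreover have "y / 2 ^ m < e" using m y assms(2) by (simp add: field_simps)
  ultimately show ?thesis using that[of "m + Suc (Suc n)"] y by simp
qed

text \<open>Every integer power of the generator is affine on the fundamental domain
  \<open>{1/4..<1/2}\<close>. The relation between \<open>z\<close> and \<open>v\<close> expresses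
  the power \<open>l - m\<close> without negative exponents.\<close>

lemma bump_01_orbit_affine:
  obtains A B where "A > 0"
    "\<And>v z. v \<in> {1/4..<1/2} \<Longrightarrow> z \<in> {0..<1} \<Longrightarrow>
      (bump_on 0 1 ^^ m) z = (bump_on 0 1 ^^ l) v \<Longrightarrow> z = A * v + B"
proof -
  let ?f = "bump_on 0 1"
  have inj1: "inj_on ?f {0..<1}" using inj_on_Bij[OF restrict_bump_Bij[of 1 0]] by (simp add: bump_on_def)
  have X: "(?f ^^ n) x \<in> {0..<1}" if "x \<in> {0..<1}" for n x
    using that bump_on_closed[of 0 1] by (induction n) auto
  have inj: "x = y" if "(?f ^^ n) x = (?f ^^ n) y" "x \<in> {0..<1}" "y \<in> {0..<1}" for n x y
    using that
  proof (induction n)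
    case (Suc n)
    then have "(?f ^^ n) x = (?f ^^ n) y"
      using inj_onD[OF inj1 _ X X] by simp
    then show ?case using Suc by simp
  qed simp
  show ?thesis
  proof (cases "m \<le> l")
    case True
    show ?thesis
    proof (rule that[of "1 / 2 ^ (l - m)" 0])
      fix v z :: real assume v: "v \<in> {1/4..<1/2}" and z: "z \<in> {0..<1}" and eq: "(?f ^^ m) z = (?f ^^ l) v"
      have "(?f ^^ l) v = (?f ^^ m) ((?f ^^ (l - m)) v)"
        using True by (metis comp_apply funpow_add le_add_diff_inverse)
      then have "z = (?f ^^ (l - m)) v"
        using inj[OF _ z X] eq v by auto
      then show "z = 1 / 2 ^ (l - m) * v + 0" using bump_funpow_half[of 0 1 v] v by simp
    qed simp
  next
    case False
    \<comment> \<open>The first backward step sends \<open>v\<close> to \<open>v + 1/4\<close>, at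
      distance \<open>3/4 - v\<close> from 1; the remaining \<open>j\<close> steps halve that
      distance.\<close>
    define j where "j = m - l - 1"
    have m: "m = l + Suc j" using False by (simp add: j_def)
    show ?thesis
    proof (rule that[of "1 / 2 ^ j" "1 - 3/4 / 2 ^ j"])
      fix v z :: real assume v: "v \<in> {1/4..<1/2}" and z: "z \<in> {0..<1}" and eq: "(?f ^^ m) z = (?f ^^ l) v"
      have "(?f ^^ l) ((?f ^^ Suc j) z) = (?f ^^ l) v" using eq by (simp only: m funpow_add o_apply)
      then have zv: "(?f ^^ Suc j) z = v" using v by (intro inj[OF _ X[OF z]]) auto
      let ?y = "1 - (3/4 - v) / 2 ^ j"
      have "(?f ^^ Suc j) ?y = ?f (1 - (3/4 - v))" using v by (simp add: bump_01_funpow_near_1)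
      also have "\<dots> = v" using v by (simp add: bump_on_apply bump_pieces)
      finally have fy: "(?f ^^ Suc j) ?y = v" .
      have "(3/4 - v) / 2 ^ j \<le> 3/4 - v" using v by (simp add: divide_le_eq mult_le_cancel_left1)
      moreover have "(3/4 - v) / 2 ^ j > 0" using v by simp
      ultimately have "?y \<in> {0..<1}" using v unfolding atLeastLessThan_iff by linarith
      then have "z = ?y" using inj z zv fy by metis
      then show "z = 1 / 2 ^ j * v + (1 - 3/4 / 2 ^ j)" by (simp add: field_simps)
    qed simp
  qed
qed

text \<open>The slope jumps from 1/2 to 1 at the midpoint; the values at three equidistant points
  contradict a single affine formula.\<close>

lemma bump_not_locally_affine:
  assumes "0 \<le> u" "u + w \<le> 1" "0 < w"
  shows "\<not> locally_affine_at (bump_on u w) (u + w/2)"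
proof
  assume "locally_affine_at (bump_on u w) (u + w/2)"
  then obtain c d e where e: "e > 0" "\<And>y. \<bar>y - (u + w/2)\<bar> < e \<Longrightarrow> bump_on u w y = c * y + d"
    by (elim locally_affine_atE) blast
  define t where "t = min (e/2) (w/4)"
  have t: "0 < t" "t < e" "t \<le> w/4" using e(1) assms(3) by (auto simp: t_def)
  have "bump_on u w (u + w/2 - t) = c * (u + w/2 - t) + d" "bump_on u w (u + w/2) = c * (u + w/2) + d"
    "bump_on u w (u + w/2 + t) = c * (u + w/2 + t) + d"
    by (rule e(2); use e(1) t in simp)+
  moreover have "bump_on u w (u + w/2 - t) = u + w/4 - t/2"
    using assms t bump_pieces(2)[of w u "u + w/2 - t"] by (simp add: bump_on_apply diff_divide_distrib add_divide_distrib)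
  moreover have "bump_on u w (u + w/2) = u + w/4"
    using assms bump_pieces(3)[of w u "u + w/2"] by (simp add: bump_on_apply)
  moreover have "bump_on u w (u + w/2 + t) = u + w/4 + t"
    using assms t bump_pieces(3)[of w u "u + w/2 + t"] by (simp add: bump_on_apply)
  ultimately show False using t(1) by (simp add: algebra_simps)
qed

section \<open>The quadratic lower bound\<close>

text \<open>Treats T and V together: containing T provides the bumps, being contained in V gives
  finitely many breaks and dyadic slopes at 0. \<open>bump_domain\<close> makes the second quarter
  of a bump a fundamental domain, with forward translates in the first quarter.\<close>

locale thompson_group = bijection_group G "{0..<1::real}" for G (structure) +
  fixes S :: "(real \<Rightarrow> real) set"
  assumes T_subset: "thompson_T_set \<subseteq> carrier G" and subset_V: "carrier G \<subseteq> thompson_V_set"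
    and finite_S: "finite S" and S_subset: "S \<subseteq> carrier G" and generate_S: "generate G S = carrier G"
    and bump_domain: "\<And>u w x. 0 \<le> u \<Longrightarrow> u + w \<le> 1 \<Longrightarrow> 0 < w \<Longrightarrow> x \<in> {0..<1} \<Longrightarrow>
      bump_on u w x \<in> {u..<u + w/4} \<longleftrightarrow> x \<in> {u + w/4..<u + w/2} \<union> {u..<u + w/4}"
begin

lemmas S_generates = S_subset generate_S

lemma finite_breaks_carrier: "f \<in> carrier G \<Longrightarrow> finite (breaks f)"
  using finite_breaks subset_V by blast

text \<open>A break of the product at \<open>x\<close> is a break of \<open>h\<close> at
  \<open>x\<close> or of \<open>f\<close> at \<open>h x\<close>; injectivity of \<open>h\<close>
  bounds the number of the latter.\<close>

lemma card_breaks_mult: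
  assumes f: "f \<in> carrier G" and h: "h \<in> carrier G"
  shows "card (breaks (f \<otimes> h)) \<le> card (breaks f) + card (breaks h)"
proof -
  let ?A = "{x \<in> {0..<1}. h x \<in> breaks f}"
  have "breaks (f \<otimes> h) \<subseteq> ?A \<union> breaks h"
  proof
    fix x assume x: "x \<in> breaks (f \<otimes> h)"
    then have x01: "0 < x" "x < 1" by (auto simp: breaks_def)
    have near: "\<forall>\<^sub>F y in nhds x. 0 < y \<and> y < 1" using x01 by (rule eventually_nhds_interval)
    show "x \<in> ?A \<union> breaks h"
    proof (cases "x \<in> breaks h")
      case False
      then have h_aff: "locally_affine_at h x" using x01 by (auto simp: breaks_def)
      then obtain c e d where c: "c > 0" "e > 0" "\<And>y. \<bar>y - x\<bar> < e \<Longrightarrow> h y = c * y + d"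
        by (elim locally_affine_atE) blast
      \<comment> \<open>Breaks of \<open>f\<close> must lie strictly above 0. A point
        \<open>y\<close> slightly left of \<open>x\<close> has \<open>0 \<le> h y < h x\<close>,
        which excludes \<open>h x = 0\<close>.\<close>
      define y where "y = x - min (e/2) (x/2)"
      have "y < x" "\<bar>y - x\<bar> < e" "0 < y" using c(2) x01 by (auto simp: y_def min_def)
      then have "h y < h x" "0 \<le> h y" using c x01 apply_closed[OF h, of y] by simp_all
      then have hx: "0 < h x" "h x < 1" using apply_closed[OF h, of x] x01 by auto
      have "\<not> locally_affine_at f (h x)"
      proof
        assume "locally_affine_at f (h x)"
        with h_aff have "locally_affine_at (\<lambda>y. f (h y)) x" by (rule locally_affine_at_compose)
        moreover have "\<forall>\<^sub>F y in nhds x. (f \<otimes> h) y = f (h y)"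
          using near by (rule eventually_mono) (simp add: mult_apply[OF f h])
        ultimately have "locally_affine_at (f \<otimes> h) x" by (rule locally_affine_at_cong[rotated])
        then show False using x by (simp add: breaks_def)
      qed
      then show ?thesis using hx x01 by (simp add: breaks_def)
    qed simp
  qed
  moreover have A: "finite ?A" "card ?A \<le> card (breaks f)"
  proof -
    have inj: "inj_on h ?A" using apply_inj[OF h] by (auto intro!: inj_onI)
    have sub: "h ` ?A \<subseteq> breaks f" by auto
    show "finite ?A" using inj_on_finite[OF inj sub] finite_breaks_carrier[OF f] by simp
    show "card ?A \<le> card (breaks f)" using card_inj_on_le[OF inj sub] finite_breaks_carrier[OF f] by simp
  qed
  ultimately have "card (breaks (f \<otimes> h)) \<le> card (?A \<union> breaks h)"
    using finite_breaks_carrier[OF h] by (intro card_mono) auto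
  also have "\<dots> \<le> card ?A + card (breaks h)" by (rule card_Un_le)
  finally show ?thesis using A(2) by simp
qed

lemma breaks_one: "breaks \<one> = {}"
proof -
  have "locally_affine_at \<one> x" if x: "0 < x" "x < 1" for x
  proof -
    have "\<forall>\<^sub>F y in nhds x. \<one> y = 1 * y + 0"
      using eventually_nhds_interval[OF x] by (rule eventually_mono) (simp add: one_apply)
    then show ?thesis by (rule locally_affine_at_cong) (rule locally_affine_at_affine, simp)
  qed
  then show ?thesis by (auto simp: breaks_def)
qed

text \<open>Subadditivity of the number of breaks along a word; \<open>M\<close> exceeds the count
  of every letter and is a successor so that it can be divided by later.\<close>

lemma card_breaks_le_word_length:
  obtains M :: nat where "M > 0" "\<And>c. c \<in> carrier G \<Longrightarrow> card (breaks c) \<le> M * word_length G S c"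
proof -
  let ?S = "S \<union> (\<lambda>s. inv s) ` S"
  define M where "M = Suc (\<Sum>s\<in>?S. card (breaks s))"
  have sub: "?S \<subseteq> carrier G" using S_subset by auto
  have fin: "finite ?S" using finite_S by simp
  have s: "card (breaks s) \<le> M" if "s \<in> ?S" for s
    using member_le_sum[OF that, of "\<lambda>s. card (breaks s)"] fin by (simp add: M_def)
  have *: "set ws \<subseteq> ?S \<Longrightarrow> card (breaks (word_prod G ws)) \<le> M * length ws" for ws
  proof (induction ws)
    case Nil
    then show ?case by (simp add: word_prod_def breaks_one)
  next
    case (Cons a ws)
    then have "a \<in> carrier G" "word_prod G ws \<in> carrier G" "card (breaks a) \<le> M"
      using sub s by (auto intro!: word_prod_closed)
    then have "card (breaks (a \<otimes> word_prod G ws)) \<le> M + card (breaks (word_prod G ws))"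
      using card_breaks_mult[of a "word_prod G ws"] by simp
    then show ?case using Cons by (simp add: word_prod_def)
  qed
  have "card (breaks c) \<le> M * word_length G S c" if c: "c \<in> carrier G" for c
  proof -
    obtain ws where "set ws \<subseteq> ?S" "length ws = word_length G S c" "word_prod G ws = c"
      using word_length_witness[OF S_generates c] by blast
    then show ?thesis using *[of ws] by simp
  qed
  then show ?thesis using that[of M] by (simp add: M_def)
qed

lemma bump_on_carrier: "a < 2 ^ m \<Longrightarrow> bump_on (real a / 2 ^ m) (1 / 2 ^ m) \<in> carrier G"
  using restrict_bump_thompson_T T_subset by (auto simp: bump_on_def)

text \<open>\<open>x1\<close> is supported in the fundamental domain \<open>[1/4, 1/2)\<close> of \<open>x0\<close>, and \<open>x2\<close> in the fundamental
  domain \<open>[5/16, 3/8)\<close> of \<open>x1\<close>.\<close>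

definition "x0 = bump_on 0 1"
definition "x1 = bump_on (1/4) (1/4)"
definition "x2 = bump_on (5/16) (1/16)"

lemma x_carrier [simp, intro]: "x0 \<in> carrier G" "x1 \<in> carrier G" "x2 \<in> carrier G"
  using bump_on_carrier[of 0 0] bump_on_carrier[of 1 2] bump_on_carrier[of 5 4]
  by (simp_all add: x0_def x1_def x2_def)

section \<open>The centralizer of \<open>x0\<close>\<close>

text \<open>Commuting elements preserve the fixed points of \<open>x0\<close>, and 0 is the only one
  in \<open>{0..<1}\<close>.\<close>

lemma centralizer_x0_fixes_0:
  assumes z: "z \<in> carrier G" and comm: "x0 \<otimes> z = z \<otimes> x0"
  shows "z 0 = 0"
proof -
  have fixed: "y = 0" if "x0 y = y" "0 \<le> y" "y < 1" for y
    using that by (cases "y \<le> 1/2"; cases "y \<le> 3/4") (simp_all add: x0_def bump_on_apply bump_pieces)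
  have "x0 0 = 0" by (simp add: x0_def bump_on_apply bump_pieces)
  then have "x0 (z 0) = z 0"
    using mult_apply[of x0 z 0] mult_apply[of z x0 0] comm z by simp
  then show ?thesis by (rule fixed) (use apply_closed[OF z, of 0] in simp_all)
qed

text \<open>Near 0 both \<open>z\<close> and \<open>x0\<close> are linear, so it suffices to match
  slopes: \<open>c / 2 ^ m = 1 / 2 ^ p\<close>.\<close>

lemma centralizer_x0_near_0:
  assumes z: "z \<in> carrier G" and z0: "z 0 = 0"
  shows "\<exists>m p e. e > 0 \<and> e \<le> 1/2 \<and> (\<forall>x\<in>{0..<e}. (x0 [^] (m::nat) \<otimes> z) x = (x0 [^] (p::nat)) x)"
proof -
  obtain c m p where c: "c > 0" "c / 2 ^ m = 1 / 2 ^ p" "\<And>x. x \<in> {0..<1 / 2 ^ m} \<Longrightarrow> z x = c * x"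
    using thompson_V_slope_at_0[OF subsetD[OF subset_V z] z0] by blast
  \<comment> \<open>The three bounds keep \<open>x\<close> in the halving region of
    \<open>x0\<close>, \<open>x\<close> in the linear piece of \<open>z\<close>, and
    \<open>c * x\<close> in the halving region.\<close>
  define e where "e = min (1/2) (min (1 / 2 ^ m) (1 / 2 / c))"
  have e: "e > 0" "e \<le> 1/2" "e \<le> 1 / 2 ^ m" "e \<le> 1 / 2 / c" using c(1) by (auto simp: e_def)
  have "(x0 [^] m \<otimes> z) x = (x0 [^] p) x" if x: "x \<in> {0..<e}" for x
  proof -
    have zx: "z x = c * x" using c(3)[of x] x e(3) by simp
    have "x < 1 / 2 / c" using x e(4) by simp
    then have "c * x < 1/2" "0 \<le> c * x" using c(1) x by (simp_all add: field_simps)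
    then have "(x0 ^^ m) (z x) = c * x / 2 ^ m"
      using bump_funpow_half[of 0 1 "c * x" m] by (simp add: zx x0_def)
    also have "\<dots> = (c / 2 ^ m) * x" by simp
    also have "\<dots> = (x0 ^^ p) x"
      using bump_funpow_half[of 0 1 x p] x e(2) by (simp add: c(2) x0_def)
    finally show ?thesis
      using z x e(2) apply_closed[OF z, of x] by (simp add: mult_apply pow_apply)
  qed
  then show ?thesis using e(1,2) by blast
qed

text \<open>Some power of \<open>x0\<close> moves any given point into \<open>{0..<e}\<close>; as
  both maps commute with that power, agreement near 0 spreads to all of
  \<open>{0..<1}\<close>.\<close>

lemma x0_commutes_eqI:
  assumes a: "a \<in> carrier G" "x0 \<otimes> a = a \<otimes> x0" and b: "b \<in> carrier G" "x0 \<otimes> b = b \<otimes> x0"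
    and near: "\<And>x. x \<in> {0..<e} \<Longrightarrow> a x = b x" and e: "e > 0"
  shows "a = b"
proof (rule eqI[OF a(1) b(1)])
  fix x :: real assume x: "x \<in> {0..<1}"
  obtain N where N: "(x0 ^^ N) x \<in> {0..<e}"
    using bump_01_funpow_small[OF x e] by (auto simp: x0_def)
  have pow: "(x0 [^] N) (f x) = f ((x0 [^] N) x)" if "f \<in> carrier G" "x0 \<otimes> f = f \<otimes> x0" for f
  proof -
    have "x0 [^] N \<otimes> f = f \<otimes> x0 [^] N" using that by (intro group_commutes_pow) auto
    then show ?thesis
      using that(1) x mult_apply[of "x0 [^] N" f x] mult_apply[of f "x0 [^] N" x] by simp
  qed
  have "a ((x0 [^] N) x) = b ((x0 [^] N) x)" using near[OF N] x by (simp add: pow_apply)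
  then have "(x0 [^] N) (a x) = (x0 [^] N) (b x)" unfolding pow[OF a] pow[OF b] .
  then show "a x = b x"
    using apply_inj[of "x0 [^] N", OF _ apply_closed[OF a(1) x] apply_closed[OF b(1) x]] by simp
qed

lemma centralizer_x0:
  assumes z: "z \<in> carrier G" and comm: "x0 \<otimes> z = z \<otimes> x0"
  shows "\<exists>(m::nat) (p::nat). x0 [^] m \<otimes> z = x0 [^] p"
proof -
  obtain m p :: nat and e where near: "e > 0" "\<And>x. x \<in> {0..<e} \<Longrightarrow> (x0 [^] m \<otimes> z) x = (x0 [^] p) x"
    using centralizer_x0_near_0[OF z centralizer_x0_fixes_0[OF z comm]] by blast
  have pow: "x0 \<otimes> x0 [^] n = x0 [^] n \<otimes> x0" for n :: nat
    using nat_pow_Suc2[of x0 n] by simp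
  then have "x0 \<otimes> (x0 [^] m \<otimes> z) = x0 [^] m \<otimes> (x0 \<otimes> z)" using z by (simp flip: m_assoc)
  then have eq: "x0 \<otimes> (x0 [^] m \<otimes> z) = x0 [^] m \<otimes> z \<otimes> x0" using comm z by (simp add: m_assoc)
  have "x0 [^] m \<otimes> z = x0 [^] p"
    by (rule x0_commutes_eqI[OF _ eq _ pow near(2,1)]) (use z in simp_all)
  then show ?thesis by blast
qed

lemma x0_domain:
  "x \<in> {0..<1} \<Longrightarrow> x0 x \<in> {0..<1/4} \<longleftrightarrow> x \<in> {1/4..<1/2} \<union> {0..<1/4}"
  using bump_domain[of 0 1 x] by (simp add: x0_def)

lemma x1_domain:
  "x \<in> {0..<1} \<Longrightarrow> x1 x \<in> {1/4..<5/16} \<longleftrightarrow> x \<in> {5/16..<3/8} \<union> {1/4..<5/16}"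
  using bump_domain[of "1/4" "1/4" x] by (simp add: x1_def)

lemma x2_support: "x \<in> {0..<1} - {5/16..<3/8} \<Longrightarrow> x2 x = x"
  using bump_outside[of "1/16" x "5/16"] by (auto simp: x2_def bump_on_apply)

section \<open>Breaks of the translated products and of all conjugators\<close>

definition f_n :: "nat \<Rightarrow> real \<Rightarrow> real" where "f_n n = spread x1 x2 n"

lemma f_n_carrier [simp, intro]: "f_n n \<in> carrier G"
  by (simp add: f_n_def)

lemma f_n_support: "x \<in> {0..<1} - {1/4..<1/2} \<Longrightarrow> f_n n x = x"
  unfolding f_n_def
  by (rule spread_support[OF x_carrier(2,3) x2_support _ x1_domain]) auto

text \<open>The point is the image under \<open>x1 ^^ l\<close> of 11/32, the midpoint of the
  support of \<open>x2\<close>. On that support \<open>x1 ^^ l\<close> is affine and conjugates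
  \<open>x2\<close> to \<open>f_n n\<close>, so affinity would carry back to \<open>x2\<close> at
  11/32.\<close>

lemma f_n_not_locally_affine:
  assumes "l < n"
  shows "\<not> locally_affine_at (f_n n) (1/4 + 3/32 / 2 ^ l)"
proof
  assume aff: "locally_affine_at (f_n n) (1/4 + 3/32 / 2 ^ l)"
  have eq: "x2 y = 2 ^ l * f_n n (1 / 2 ^ l * y + (1/4 - 1/4 / 2 ^ l)) + (1/4 - 2 ^ l / 4)"
    if y: "5/16 < y" "y < 3/8" for y
  proof -
    have x2y: "x2 y \<in> {5/16..<3/8}"
    proof (rule ccontr)
      have X: "x2 y \<in> {0..<1}" "y \<in> {0..<1}" using apply_closed[OF x_carrier(3), of y] y by auto
      moreover assume out: "x2 y \<notin> {5/16..<3/8}"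
      ultimately have "x2 (x2 y) = x2 y" by (intro x2_support) blast
      then have "x2 y = y" by (rule apply_inj[of x2, OF x_carrier(3) X])
      then show False using y out by simp
    qed
    have pow: "(x1 ^^ l) v = 1/4 + (v - 1/4) / 2 ^ l" if "v \<in> {1/4..<3/8}" for v
      using bump_funpow_half[of "1/4" "1/4" v l] that by (simp add: x1_def)
    have "f_n n ((x1 ^^ l) y) = (x1 ^^ l) (x2 y)" unfolding f_n_def
      by (rule spread_apply[OF x_carrier(2,3) x2_support _ x1_domain]) (use y assms in auto)
    then have "f_n n (1/4 + (y - 1/4) / 2 ^ l) = 1/4 + (x2 y - 1/4) / 2 ^ l"
      using y x2y by (simp add: pow)
    moreover have "1/4 + (y - 1/4) / 2 ^ l = 1 / 2 ^ l * y + (1/4 - 1/4 / 2 ^ l)"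
      by (simp add: field_simps)
    ultimately show ?thesis by (simp add: field_simps)
  qed
  have "locally_affine_at (\<lambda>y. 1 / 2 ^ l * y + (1/4 - 1/4 / 2 ^ l)) (11/32)"
    by (rule locally_affine_at_affine) simp
  then have "locally_affine_at (\<lambda>y. f_n n (1 / 2 ^ l * y + (1/4 - 1/4 / 2 ^ l))) (11/32)"
  proof (rule locally_affine_at_compose)
    have "1/4 + t * (11/32 - 1/4) = t * (11/32) + (1/4 - 1/4 * t)" for t :: real
      by (simp add: algebra_simps)
    from this[of "1 / 2 ^ l"] have "1/4 + 3/32 / 2 ^ l = 1 / 2 ^ l * (11/32) + (1/4 - 1/4 / 2 ^ l :: real)"
      by simp
    then show "locally_affine_at (f_n n) (1 / 2 ^ l * (11/32) + (1/4 - 1/4 / 2 ^ l))" using aff by metis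
  qed
  then have "locally_affine_at
      (\<lambda>y. 2 ^ l * f_n n (1 / 2 ^ l * y + (1/4 - 1/4 / 2 ^ l)) + (1/4 - 2 ^ l / 4)) (11/32)"
    by (rule locally_affine_at_compose[OF _ locally_affine_at_affine]) simp
  moreover have "\<forall>\<^sub>F y in nhds (11/32). x2 y =
      2 ^ l * f_n n (1 / 2 ^ l * y + (1/4 - 1/4 / 2 ^ l)) + (1/4 - 2 ^ l / 4)"
    by (rule eventually_mono[OF eventually_nhds_interval[of "5/16" _ "3/8"]]) (use eq in auto)
  ultimately have "locally_affine_at x2 (11/32)" by (rule locally_affine_at_cong[rotated])
  then show False using bump_not_locally_affine[of "5/16" "1/16"] by (simp add: x2_def)
qed

definition k_n :: "nat \<Rightarrow> real \<Rightarrow> real" where "k_n n = spread x0 (f_n n) n"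

lemma k_n_carrier [simp, intro]: "k_n n \<in> carrier G"
  by (simp add: k_n_def)

text \<open>By \<open>eq\<close>, \<open>c\<close> is \<open>k_n n\<close> followed by the power
  \<open>p - m\<close> of \<open>x0\<close>. On the i-th translate of the fundamental domain it is
  thus \<open>f_n n\<close> between two powers of \<open>x0\<close>, both affine there, so it
  inherits the breaks of \<open>f_n n\<close>.\<close>

lemma conjugator_not_locally_affine:
  assumes c: "c \<in> carrier G" and eq: "x0 [^] (m::nat) \<otimes> c = x0 [^] (p::nat) \<otimes> k_n n"
    and "i < n" "l < n"
  shows "\<not> locally_affine_at c ((1/4 + 3/32 / 2 ^ l) / 2 ^ i)"
proof
  let ?y = "1/4 + 3/32 / 2 ^ l :: real"
  assume aff: "locally_affine_at c (?y / 2 ^ i)"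
  obtain A B where A: "A > 0" "\<And>v z. v \<in> {1/4..<1/2} \<Longrightarrow> z \<in> {0..<1} \<Longrightarrow>
      (x0 ^^ m) z = (x0 ^^ (p + i)) v \<Longrightarrow> z = A * v + B"
    unfolding x0_def using bump_01_orbit_affine[of m "p + i"] by metis
  have eq': "f_n n y = 1 / A * c (1 / 2 ^ i * y + 0) + - B / A" if y: "1/4 < y" "y < 1/2" for y
  proof -
    have fy: "f_n n y \<in> {1/4..<1/2}"
    proof (rule ccontr)
      have X: "f_n n y \<in> {0..<1}" "y \<in> {0..<1}" using apply_closed[OF f_n_carrier, of y n] y by auto
      moreover assume out: "f_n n y \<notin> {1/4..<1/2}"
      ultimately have "f_n n (f_n n y) = f_n n y" by (intro f_n_support) blast
      then have "f_n n y = y" by (rule apply_inj[of "f_n n", OF f_n_carrier X])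
      then show False using y out by simp
    qed
    have pow: "(x0 ^^ i) y = y / 2 ^ i" using bump_funpow_half[of 0 1 y i] y by (simp add: x0_def)
    have "y / 2 ^ i < 1" using divide_power2_le[of y i] y by linarith
    then have X: "y / 2 ^ i \<in> {0..<1}" using y by (simp del: divide_less_eq_1_pos)
    have k: "k_n n (y / 2 ^ i) = (x0 ^^ i) (f_n n y)" unfolding k_n_def pow[symmetric]
      by (rule spread_apply[OF x_carrier(1) f_n_carrier f_n_support _ x0_domain])
        (use y assms(3) in auto)
    have "(x0 ^^ m) (c (y / 2 ^ i)) = (x0 [^] m \<otimes> c) (y / 2 ^ i)"
      using c X pow_apply[OF x_carrier(1) apply_closed[OF c X]] mult_apply[of "x0 [^] m" c "y / 2 ^ i"]
      by simp
    also have "\<dots> = (x0 ^^ p) (k_n n (y / 2 ^ i))"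
      unfolding eq using X pow_apply[OF x_carrier(1) apply_closed[OF k_n_carrier X]]
        mult_apply[of "x0 [^] p" "k_n n" "y / 2 ^ i"] by simp
    also have "\<dots> = (x0 ^^ (p + i)) (f_n n y)" by (simp add: k funpow_add)
    finally have "c (y / 2 ^ i) = A * f_n n y + B"
      using A(2)[OF fy] apply_closed[OF c X] by blast
    then show ?thesis using A(1) by (simp add: field_simps)
  qed
  have y: "1/4 < ?y" "?y < 1/2" using divide_power2_le[of "3/32" l] by simp_all
  have "locally_affine_at (\<lambda>y. 1 / 2 ^ i * y + 0) ?y"
    by (rule locally_affine_at_affine) simp
  then have "locally_affine_at (\<lambda>y. c (1 / 2 ^ i * y + 0)) ?y"
    by (rule locally_affine_at_compose) (use aff in simp)
  then have "locally_affine_at (\<lambda>y. 1 / A * c (1 / 2 ^ i * y + 0) + - B / A) ?y"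
    by (rule locally_affine_at_compose[OF _ locally_affine_at_affine]) (use A(1) in simp)
  moreover have "\<forall>\<^sub>F y in nhds ?y. f_n n y = 1 / A * c (1 / 2 ^ i * y + 0) + - B / A"
    using eventually_nhds_interval[OF y] by (rule eventually_mono) (use eq' in auto)
  ultimately have "locally_affine_at (f_n n) ?y" by (rule locally_affine_at_cong[rotated])
  then show False using f_n_not_locally_affine assms(4) by blast
qed

text \<open>Two conjugators from \<open>x0\<close> to \<open>h\<close> differ on the left by an
  element of the centralizer of \<open>x0\<close>, which is a power of \<open>x0\<close> up to
  another power; so all \<open>n * n\<close> breaks persist.\<close>

lemma card_breaks_conjugator:
  assumes c: "c \<in> carrier G" and h: "h \<in> carrier G"
    and conj: "x0 \<otimes> c = c \<otimes> h" "x0 \<otimes> k_n n = k_n n \<otimes> h"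
  shows "n * n \<le> card (breaks c)"
proof -
  define z where "z = c \<otimes> inv (k_n n)"
  have z: "z \<in> carrier G" "c = z \<otimes> k_n n" using c by (simp_all add: z_def m_assoc)
  have "x0 \<otimes> z = z \<otimes> x0"
  proof -
    have "x0 \<otimes> z \<otimes> k_n n = z \<otimes> x0 \<otimes> k_n n"
      using conj z h by (simp add: m_assoc)
    then show ?thesis using z(1) by (subst (asm) right_cancel) simp_all
  qed
  then obtain m p :: nat where "x0 [^] m \<otimes> z = x0 [^] p" using centralizer_x0[OF z(1)] by blast
  then have eq: "x0 [^] m \<otimes> c = x0 [^] p \<otimes> k_n n" using z by (simp flip: m_assoc)
  define y :: "nat \<Rightarrow> real" where "y l = 1/4 + 3/32 / 2 ^ l" for l
  define q where "q = (\<lambda>(i, l). y l / 2 ^ i)"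
  have y: "1/4 < y l" "y l < 1/2" for l
    using divide_power2_le[of "3/32" l] by (simp_all add: y_def)
  have "q (i, l) \<in> breaks c" if "i < n" "l < n" for i l
  proof -
    have "y l / 2 ^ i < 1" using divide_power2_le[of "y l" i] y[of l] by linarith
    moreover have "0 < y l / 2 ^ i" using y[of l] by simp
    ultimately show ?thesis
      using conjugator_not_locally_affine[OF c eq that] by (simp add: breaks_def q_def y_def)
  qed
  then have sub: "q ` ({..<n} \<times> {..<n}) \<subseteq> breaks c" by auto
  \<comment> \<open>All \<open>y l\<close> lie strictly between 1/4 and 1/2, so scaling by different
    powers of 2 puts them into disjoint intervals.\<close>
  have not_less: "\<not> i < j" if "y l / 2 ^ i = y l' / 2 ^ j" for i j l l'
  proof
    assume "i < j"
    then obtain d where j: "j = Suc (i + d)" using less_imp_Suc_add by blast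
    have "y l = y l' / 2 / 2 ^ d" using that by (simp add: j power_add field_simps)
    also have "\<dots> \<le> y l' / 2" using y[of l'] by (intro divide_power2_le) simp
    finally show False using y[of l] y[of l'] by simp
  qed
  have "inj q"
  proof (rule injI, clarify)
    fix i l j l' assume "q (i, l) = q (j, l')"
    then have eq: "y l / 2 ^ i = y l' / 2 ^ j" by (simp add: q_def)
    then have "i = j" using not_less[OF eq] not_less[OF eq[symmetric]] by simp
    moreover from this have "y l = y l'" using eq by simp
    then have "l = l'" by (simp add: y_def)
    ultimately show "i = j \<and> l = l'" by simp
  qed
  then have "card (q ` ({..<n} \<times> {..<n})) = n * n"
    by (subst card_image) (auto intro: inj_on_subset)
  then show ?thesis using card_mono[OF finite_breaks_carrier[OF c] sub] by simp
qed

text \<open>The pair \<open>x0\<close>, \<open>h\<close> has total length at most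
  \<open>K * n\<close>, but every conjugator has at least \<open>n * n\<close> breaks and hence
  length at least \<open>n * n / M\<close>.\<close>

lemma CLF_quadratic_lower_bound:
  "\<exists>C::real. C > 0 \<and> (\<exists>N::nat. \<forall>n\<ge>N. real (CLF G S n) \<ge> C * (real n)\<^sup>2)"
proof -
  obtain M :: nat where M: "M > 0" "\<And>c. c \<in> carrier G \<Longrightarrow> card (breaks c) \<le> M * word_length G S c"
    using card_breaks_le_word_length by blast
  let ?l = "word_length G S"
  \<comment> \<open>\<open>n * L\<close> bounds the length of \<open>f_n n\<close>, and
    \<open>n * K\<close> that of \<open>x0\<close> and \<open>h\<close> together; \<open>Suc\<close>
    makes \<open>K\<close> a valid divisor.\<close>
  define L where "L = 2 * ?l x1 + ?l x2"
  define K where "K = Suc (4 * ?l x0 + 2 * L)"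
  have quadratic: "n * n \<le> M * CLF G S N" if n: "n \<ge> 1" "K * n \<le> N" for n N
  proof -
    define f where "f = x0 [^] n \<otimes> f_n n \<otimes> inv (x0 [^] n)"
    define h where "h = inv (f_n n) \<otimes> f \<otimes> x0"
    have f: "f \<in> carrier G" and h: "h \<in> carrier G" by (simp_all add: f_def h_def)
    have "f_n n \<otimes> k_n n = k_n n \<otimes> f_n n" unfolding k_n_def
      by (rule spread_commute[OF x_carrier(1) f_n_carrier f_n_support _ x0_domain]) auto
    then have kh: "x0 \<otimes> k_n n = k_n n \<otimes> h"
      unfolding k_n_def h_def f_def by (intro spread_conj) simp_all
    then have "h = inv (k_n n) \<otimes> x0 \<otimes> k_n n"
      using h by (simp add: m_assoc) (simp flip: m_assoc)
    then have conj: "conjugates G x0 h"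
      unfolding conjugates_def using h k_n_carrier x_carrier(1) by blast
    have lf_n: "?l (f_n n) \<le> n * L"
      unfolding f_n_def L_def by (rule word_length_spread[OF S_generates]) simp_all
    have pow: "?l (x0 [^] n) \<le> n * ?l x0" by (rule word_length_pow[OF S_generates]) simp
    have "?l f \<le> ?l (x0 [^] n) + ?l (f_n n) + ?l (inv (x0 [^] n))"
      unfolding f_def
      by (rule order_trans[OF word_length_mult[OF S_generates]])
        (use word_length_mult[OF S_generates] in simp_all)
    also have "\<dots> \<le> n * ?l x0 + n * L + n * ?l x0"
      using pow lf_n word_length_inv[OF S_generates, of "x0 [^] n"] by simp
    finally have lf: "?l f \<le> n * ?l x0 + n * L + n * ?l x0" .
    have "?l h \<le> ?l (inv (f_n n)) + ?l f + ?l x0"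
      unfolding h_def using f
      by (intro order_trans[OF word_length_mult[OF S_generates]])
        (use word_length_mult[OF S_generates] in simp_all)
    also have "\<dots> \<le> n * L + (n * ?l x0 + n * L + n * ?l x0) + ?l x0"
      using lf lf_n word_length_inv[OF S_generates, of "f_n n"] by simp
    finally have "?l x0 + ?l h \<le> 2 * ?l x0 + n * (2 * ?l x0 + 2 * L)"
      by (simp add: algebra_simps)
    \<comment> \<open>\<open>n \<ge> 1\<close> absorbs the two constant terms: \<open>x0\<close>
      itself and the last factor of \<open>h\<close>.\<close>
    moreover have "2 * ?l x0 \<le> n * (2 * ?l x0)" using n(1) by simp
    ultimately have "?l x0 + ?l h \<le> n * (2 * ?l x0) + n * (2 * ?l x0 + 2 * L)" by linarith
    then have "?l x0 + ?l h \<le> n * (4 * ?l x0 + 2 * L)" by (simp add: algebra_simps)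
    then have "?l x0 + ?l h \<le> N" using n(2) by (simp add: K_def algebra_simps)
    then have cd: "conjugator_distance G S x0 h \<le> CLF G S N"
      using CLF_ge[OF finite_S S_generates conj] by blast
    obtain c where c: "c \<in> carrier G" "x0 \<otimes> c = c \<otimes> h" "?l c = conjugator_distance G S x0 h"
      using conjugator_distance_witness[OF conj] by blast
    have "n * n \<le> card (breaks c)" by (rule card_breaks_conjugator[OF c(1) h c(2) kh])
    also have "\<dots> \<le> M * ?l c" by (rule M(2)[OF c(1)])
    also have "\<dots> \<le> M * CLF G S N" using cd c(3) by simp
    finally show ?thesis .
  qed
  \<comment> \<open>With \<open>n = N div K\<close> one has \<open>N < 2 * K * n\<close>, so
    \<open>N^2\<close> is at most \<open>4 * K^2 * n^2\<close>, hence at most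
    \<open>4 * K^2 * M\<close> times the value of \<open>CLF\<close> at \<open>N\<close>.\<close>
  define C :: real where "C = 1 / (4 * (real K)\<^sup>2 * real M)"
  have K: "K > 0" by (simp add: K_def)
  have "C * (real N)\<^sup>2 \<le> real (CLF G S N)" if N: "N \<ge> K" for N
  proof -
    define n where "n = N div K"
    have n: "n \<ge> 1" "K * n \<le> N" using N K by (simp_all add: n_def div_greater_zero_iff Suc_le_eq)
    have "N < K * n + K" using K dividend_less_div_times[of K N] by (simp add: n_def mult.commute)
    also have "\<dots> \<le> 2 * K * n" using n(1) by simp
    finally have "real N \<le> 2 * real K * real n"
      by (metis less_imp_le of_nat_le_iff of_nat_mult of_nat_numeral)
    then have "(real N)\<^sup>2 \<le> (2 * real K * real n)\<^sup>2" by (intro power_mono) simp_all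
    also have "\<dots> = 4 * (real K)\<^sup>2 * real (n * n)" by (simp add: power2_eq_square)
    also have "\<dots> \<le> 4 * (real K)\<^sup>2 * real (M * CLF G S N)"
      using quadratic[OF n] by (intro mult_left_mono of_nat_mono) simp_all
    finally show ?thesis using K M(1) by (simp add: C_def field_simps)
  qed
  moreover have "C > 0" using K M(1) by (simp add: C_def)
  ultimately show ?thesis by blast
qed

end

text \<open>Closure under products is obtained without refining partitions:
  \<open>generate G S\<close> is closed under products by construction, and \<open>gen\<close>
  identifies it with the carrier.\<close>

lemma bijection_group_of_generate:
  fixes G :: "('a \<Rightarrow> 'a) monoid"
  assumes G: "G = (BijGroup X) \<lparr>carrier := H\<rparr>" and H: "H \<subseteq> Bij X"
    and inv: "\<And>f. f \<in> H \<Longrightarrow> restrict (inv_into X f) X \<in> H" and gen: "generate G S = carrier G"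
  shows "bijection_group G X"
proof -
  have carrier: "carrier G = H" and mult: "f \<otimes>\<^bsub>G\<^esub> h = f \<otimes>\<^bsub>BijGroup X\<^esub> h"
    and one: "\<one>\<^bsub>G\<^esub> = \<one>\<^bsub>BijGroup X\<^esub>" for f h
    by (simp_all add: G)
  have "subgroup (carrier G) (BijGroup X)"
  proof
    show "carrier G \<subseteq> carrier (BijGroup X)" using H carrier by (simp add: BijGroup_def)
    show "f \<otimes>\<^bsub>BijGroup X\<^esub> h \<in> carrier G" if "f \<in> carrier G" "h \<in> carrier G" for f h
      using generate.eng[of f G S h] that gen mult by simp
    show "\<one>\<^bsub>BijGroup X\<^esub> \<in> carrier G" using generate.one[of G S] gen one by simp
    show "inv\<^bsub>BijGroup X\<^esub> f \<in> carrier G" if "f \<in> carrier G" for f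
      using inv_BijGroup[of f X] that inv H carrier by auto
  qed
  moreover from this have "group G"
    using group.subgroup_imp_group[OF group_BijGroup, of H X] by (simp add: G)
  moreover have "G = (BijGroup X) \<lparr>carrier := carrier G\<rparr>" by (simp add: G)
  ultimately show ?thesis by (intro bijection_group.intro bijection_group_axioms.intro)
qed

theorem theorem4p5:
  fixes G :: "(real \<Rightarrow> real) monoid" and S :: "(real \<Rightarrow> real) set"
  assumes "G = thompson_T \<or> G = thompson_V"
    and "finite S" and "S \<subseteq> carrier G" and "generate G S = carrier G"
  shows "\<exists>C::real. C > 0 \<and> (\<exists>N::nat. \<forall>n\<ge>N. real (CLF G S n) \<ge> C * (real n)\<^sup>2)"
proof -
  have V: "thompson_V_set \<subseteq> Bij {0..<1}" by (auto simp: thompson_V_set_def)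
  have T: "thompson_T_set \<subseteq> thompson_V_set" by (auto simp: thompson_T_set_def)
  from assms(1) have "bijection_group G {0..<1}"
  proof
    assume "G = thompson_T"
    then show ?thesis
      using T V thompson_T_set_inv assms(4)
      by (intro bijection_group_of_generate[where H = thompson_T_set and S = S]) (auto simp: thompson_T_def)
  next
    assume "G = thompson_V"
    then show ?thesis
      using V thompson_V_set_inv assms(4)
      by (intro bijection_group_of_generate[where H = thompson_V_set and S = S]) (auto simp: thompson_V_def)
  qed
  moreover have "carrier G = thompson_T_set \<or> carrier G = thompson_V_set"
    using assms(1) by (auto simp: thompson_T_def thompson_V_def)
  moreover have "bump_on u w x \<in> {u..<u + w/4} \<longleftrightarrow> x \<in> {u + w/4..<u + w/2} \<union> {u..<u + w/4}"
    if "0 \<le> u" "u + w \<le> 1" "0 < w" "x \<in> {0..<1}" for u w x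
    using that
    by (cases "x \<le> u"; cases "x \<le> u + w/2"; cases "x \<le> u + 3*w/4"; cases "x \<le> u + w";
      auto simp: bump_on_apply bump_pieces)
  ultimately have "thompson_group G S"
    using T assms(2-4) by (intro thompson_group.intro thompson_group_axioms.intro) auto
  then show ?thesis by (rule thompson_group.CLF_quadratic_lower_bound)
qed

end
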